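(* For every $\epsilon\in(0,1)$ and $\phi'<\frac12$, every $n$-vertex graph $G$ has an $(\epsilon,\phi')$ vertex sample set of size $\min\{\Theta(n\frac{\phi'}{\epsilon^2}\log(\frac{n\phi'}{\epsilon^3})), n\}$. Further, there is a randomized algorithm that computes such a set with constant probability in near-linear time.
   Context: Graphs are finite, connected and undirected, with $n$ vertices and $m$ edges; near-linear time means $\tilde O(m)$, i.e. $O(m)$ up to polylogarithmic factors. $N_G(W)$ is the set of vertices outside $W$ having a neighbour in $W$. The vertex sparsity of $W$ is $\phi(W)=\frac{|N_G(W)|}{|W\cup N_G(W)|}$, and for a terminal set $T\subseteq V(G)$ the vertex terminal sparsity is $\phi_T(W)=\frac{|N_G(W)|}{|(W\cup N_G(W))\cap T|}$ (taken to be $+\infty$ when the denominator is zero). An $(\epsilon,\phi')$ vertex sample set for $G$ is a nonempty set $T\subseteq V(G)$ with the following property. Let $W\subseteq V(G)$ be either (a) a connected component after removing a vertex cut (a set of vertices), or (b) the union of all connected components except one after removing a vertex cut. Suppose further that either $\phi(W)\le\phi'$ or $\phi_T(W)\le\frac{n}{|T|}\cdot\frac{\phi'}{10}$. Then $\left|\frac{n}{|T|}|W\cap T|-|W|\right|\le\epsilon|W|$.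
   Formalization: In case (b) the removed vertex cut must equal N_G(W), since arbitrary cuts in a star make the claim false (no loss in (a)); the expression inside Θ is replaced by its maximum with 1 (by 1 if φ'≤0), as T is nonempty; the algorithm may use exact real arithmetic with ln. *)

theory Defs
  imports "HOL-Probability.Probability"
begin

section \<open>Graphs and vertex cuts\<close>

definition simple_graph :: "'a set \<Rightarrow> 'a set set \<Rightarrow> bool" where
  "simple_graph V E \<longleftrightarrow>
     finite V \<and> V \<noteq> {} \<and> E \<subseteq> {{u, v} | u v. u \<in> V \<and> v \<in> V \<and> u \<noteq> v}"

text \<open>Adjacency inside the subgraph induced by \<open>S\<close>, and its connected components.\<close>

definition induced_adj :: "'a set set \<Rightarrow> 'a set \<Rightarrow> ('a \<times> 'a) set" where
  "induced_adj E S = {(u, v). u \<in> S \<and> v \<in> S \<and> {u, v} \<in> E}"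

definition components :: "'a set set \<Rightarrow> 'a set \<Rightarrow> 'a set set" where
  "components E S = {{v \<in> S. (u, v) \<in> (induced_adj E S)\<^sup>*} | u. u \<in> S}"

definition connected_graph :: "'a set \<Rightarrow> 'a set set \<Rightarrow> bool" where
  "connected_graph V E \<longleftrightarrow>
     simple_graph V E \<and> (\<forall>u\<in>V. \<forall>v\<in>V. (u, v) \<in> (induced_adj E V)\<^sup>*)"

definition nbhd :: "'a set \<Rightarrow> 'a set set \<Rightarrow> 'a set \<Rightarrow> 'a set" where
  "nbhd V E W = {v \<in> V - W. \<exists>u\<in>W. {u, v} \<in> E}"

text \<open>
  The vertex cut \<open>X\<close> that is removed is the boundary \<open>nbhd V E W\<close> of the side \<open>W\<close>. For a single
  component this is no restriction: a component of \<open>V - X\<close> is also a component of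
  \<open>V - nbhd V E W\<close>. For a union of all components but one it is essential. If \<open>X\<close> could
  contain vertices not adjacent to \<open>W\<close>, then in a star (remove the centre and an arbitrary set of
  leaves) nearly every set of leaves would be such a \<open>W\<close>, with a boundary of size one, and
  sublinear sample sets would not exist.
\<close>

definition cut_side :: "'a set \<Rightarrow> 'a set set \<Rightarrow> 'a set \<Rightarrow> bool" where
  "cut_side V E W \<longleftrightarrow>
     (\<exists>X \<subseteq> V. nbhd V E W = X \<and>
        (W \<in> components E (V - X) \<or>
         (\<exists>C \<in> components E (V - X). W = \<Union> (components E (V - X) - {C}))))"

section \<open>Vertex sample sets\<close>

definition vertex_sparsity :: "'a set \<Rightarrow> 'a set set \<Rightarrow> 'a set \<Rightarrow> real" where
  "vertex_sparsity V E W = real (card (nbhd V E W)) / real (card (W \<union> nbhd V E W))"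

definition terminal_sparsity :: "'a set \<Rightarrow> 'a set set \<Rightarrow> 'a set \<Rightarrow> 'a set \<Rightarrow> ereal" where
  "terminal_sparsity V E T W =
     (if card ((W \<union> nbhd V E W) \<inter> T) = 0 then \<infinity>
      else ereal (real (card (nbhd V E W)) / real (card ((W \<union> nbhd V E W) \<inter> T))))"

definition vertex_sample_set ::
  "'a set \<Rightarrow> 'a set set \<Rightarrow> real \<Rightarrow> real \<Rightarrow> 'a set \<Rightarrow> bool" where
  "vertex_sample_set V E \<epsilon> \<phi>' T \<longleftrightarrow>
     T \<subseteq> V \<and> T \<noteq> {} \<and>
     (\<forall>W \<subseteq> V. cut_side V E W \<longrightarrow>
        vertex_sparsity V E W \<le> \<phi>' \<or>
        terminal_sparsity V E T W \<le> ereal (real (card V) / real (card T) * (\<phi>' / 10)) \<longrightarrow>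
        \<bar>real (card V) / real (card T) * real (card (W \<inter> T)) - real (card W)\<bar>
          \<le> \<epsilon> * real (card W))"

text \<open>
  The function inside the Theta. A sample set is nonempty, so the value is at least 1; the
  maximum also covers arguments for which the logarithm is close to 0 or negative, and the
  case distinction those for which it is undefined.
\<close>

definition sample_size :: "nat \<Rightarrow> real \<Rightarrow> real \<Rightarrow> real" where
  "sample_size n \<epsilon> \<phi>' =
     (if \<phi>' \<le> 0 then 1
      else max 1 (real n * (\<phi>' / \<epsilon>\<^sup>2) * ln (real n * \<phi>' / \<epsilon> ^ 3)))"

definition is_sample_size_fun :: "(nat \<Rightarrow> real \<Rightarrow> real \<Rightarrow> nat) \<Rightarrow> bool" where
  "is_sample_size_fun s \<longleftrightarrow>
     (\<exists>c1 > 0. \<exists>c2 > 0. \<forall>n \<epsilon> \<phi>'. 1 \<le> n \<and> 0 < \<epsilon> \<and> \<epsilon> < 1 \<and> \<phi>' < 1 / 2 \<longrightarrow>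
        c1 * sample_size n \<epsilon> \<phi>' \<le> real (s n \<epsilon> \<phi>') \<and>
        real (s n \<epsilon> \<phi>') \<le> c2 * sample_size n \<epsilon> \<phi>')"

section \<open>A randomized RAM\<close>

text \<open>
  A word RAM with \<open>w\<close>-bit words (all word results are reduced modulo \<open>2 ^ w\<close>) and unit cost per
  instruction, extended with real registers as in the real RAM: the parameters of the problem are
  arbitrary real numbers. Real values influence the word part only through comparisons; in
  particular there is no rounding of reals to words. The logarithm of a real is a primitive
  because the required sample size is defined by one. The first argument of an instruction is the
  target register, except for \<open>WStore a b\<close>, which writes register \<open>b\<close> to the cell addressed by
  register \<open>a\<close>, and for the jumps, whose last argument is the target.
\<close>

datatype instr =
    WConst nat nat
  | WAdd nat nat nat
  | WSub nat nat nat
  | WMul nat nat nat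
  | WDiv nat nat nat
  | WLoad nat nat
  | WStore nat nat
  | WRand nat nat
  | Jump nat
  | WJumpLess nat nat nat
  | ROfWord nat nat
  | RAdd nat nat nat
  | RSub nat nat nat
  | RMul nat nat nat
  | RDiv nat nat nat
  | RLn nat nat
  | RJumpLess nat nat nat

record config =
  pc :: nat
  wreg :: "nat \<Rightarrow> nat"
  mem :: "nat \<Rightarrow> nat"
  rreg :: "nat \<Rightarrow> real"

definition next_pc :: "config \<Rightarrow> config" where
  "next_pc c = c\<lparr>pc := Suc (pc c)\<rparr>"

definition set_word :: "nat \<Rightarrow> nat \<Rightarrow> nat \<Rightarrow> config \<Rightarrow> config" where
  "set_word w d x c = next_pc (c\<lparr>wreg := (wreg c)(d := x mod 2 ^ w)\<rparr>)"

definition set_real :: "nat \<Rightarrow> real \<Rightarrow> config \<Rightarrow> config" where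
  "set_real d x c = next_pc (c\<lparr>rreg := (rreg c)(d := x)\<rparr>)"

text \<open>\<open>WRand d a\<close> draws a uniform element of \<open>{0..<k}\<close>, where \<open>k\<close> is the content of register \<open>a\<close>
  (and yields 0 if \<open>k = 0\<close>).\<close>

fun exec_instr :: "nat \<Rightarrow> instr \<Rightarrow> config \<Rightarrow> config pmf" where
  "exec_instr w (WConst d k) c = return_pmf (set_word w d k c)"
| "exec_instr w (WAdd d a b) c = return_pmf (set_word w d (wreg c a + wreg c b) c)"
| "exec_instr w (WSub d a b) c = return_pmf (set_word w d (wreg c a - wreg c b) c)"
| "exec_instr w (WMul d a b) c = return_pmf (set_word w d (wreg c a * wreg c b) c)"
| "exec_instr w (WDiv d a b) c = return_pmf (set_word w d (wreg c a div wreg c b) c)"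
| "exec_instr w (WLoad d a) c = return_pmf (set_word w d (mem c (wreg c a)) c)"
| "exec_instr w (WStore a b) c =
     return_pmf (next_pc (c\<lparr>mem := (mem c)(wreg c a := wreg c b)\<rparr>))"
| "exec_instr w (WRand d a) c =
     (if wreg c a = 0 then return_pmf (set_word w d 0 c)
      else map_pmf (\<lambda>x. set_word w d x c) (pmf_of_set {0..<wreg c a}))"
| "exec_instr w (Jump l) c = return_pmf (c\<lparr>pc := l\<rparr>)"
| "exec_instr w (WJumpLess a b l) c =
     return_pmf (if wreg c a < wreg c b then c\<lparr>pc := l\<rparr> else next_pc c)"
| "exec_instr w (ROfWord d a) c = return_pmf (set_real d (real (wreg c a)) c)"
| "exec_instr w (RAdd d a b) c = return_pmf (set_real d (rreg c a + rreg c b) c)"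
| "exec_instr w (RSub d a b) c = return_pmf (set_real d (rreg c a - rreg c b) c)"
| "exec_instr w (RMul d a b) c = return_pmf (set_real d (rreg c a * rreg c b) c)"
| "exec_instr w (RDiv d a b) c = return_pmf (set_real d (rreg c a / rreg c b) c)"
| "exec_instr w (RLn d a) c = return_pmf (set_real d (ln (rreg c a)) c)"
| "exec_instr w (RJumpLess a b l) c =
     return_pmf (if rreg c a < rreg c b then c\<lparr>pc := l\<rparr> else next_pc c)"

definition halted :: "instr list \<Rightarrow> config \<Rightarrow> bool" where
  "halted P c \<longleftrightarrow> length P \<le> pc c"

definition step :: "nat \<Rightarrow> instr list \<Rightarrow> config \<Rightarrow> config pmf" where
  "step w P c = (if halted P c then return_pmf c else exec_instr w (P ! pc c) c)"

primrec run :: "nat \<Rightarrow> instr list \<Rightarrow> nat \<Rightarrow> config \<Rightarrow> config pmf" where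
  "run w P 0 c = return_pmf c"
| "run w P (Suc k) c = bind_pmf (step w P c) (run w P k)"

text \<open>
  A graph with vertex set \<open>{..<n}\<close> is given by a list of its edges, in any order and orientation,
  without repetition. Memory initially holds \<open>n\<close>, the number of edges, and the endpoints of the
  edges; real registers 0 and 1 hold the two parameters. At the end, cell 0 holds the size \<open>k\<close> of
  the output list, and the cells \<open>1, \<dots>, k\<close> hold its elements.
\<close>

definition edge_list :: "nat set set \<Rightarrow> (nat \<times> nat) list \<Rightarrow> bool" where
  "edge_list E es \<longleftrightarrow>
     distinct (map (\<lambda>(u, v). {u, v}) es) \<and> set (map (\<lambda>(u, v). {u, v}) es) = E"

definition encode_graph :: "nat \<Rightarrow> (nat \<times> nat) list \<Rightarrow> nat list" where
  "encode_graph n es = n # length es # concat (map (\<lambda>(u, v). [u, v]) es)"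

definition init_config :: "nat \<Rightarrow> (nat \<times> nat) list \<Rightarrow> real \<Rightarrow> real \<Rightarrow> config" where
  "init_config n es \<epsilon> \<phi>' =
     \<lparr>pc = 0,
      wreg = (\<lambda>_. 0),
      mem = (\<lambda>i. if i < length (encode_graph n es) then encode_graph n es ! i else 0),
      rreg = (\<lambda>_. 0)(0 := \<epsilon>, 1 := \<phi>')\<rparr>"

definition output_set :: "config \<Rightarrow> nat set" where
  "output_set c = mem c ` {1..mem c 0}"

text \<open>
  \<open>computes_sample_sets s P \<kappa> C d p\<close>: for every word length of at least \<open>\<kappa> log (n + 2)\<close> bits, the
  program \<open>P\<close> always halts within \<open>C (m + 1) (log (n + 2)) ^ d\<close> instructions, and with probability
  at least \<open>p\<close> its output is a vertex sample set of the prescribed size. The \<open>+ 1\<close> only matters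
  for the graph without edges.
\<close>

definition computes_sample_sets ::
  "(nat \<Rightarrow> real \<Rightarrow> real \<Rightarrow> nat) \<Rightarrow> instr list \<Rightarrow> nat \<Rightarrow> real \<Rightarrow> nat \<Rightarrow> real \<Rightarrow> bool" where
  "computes_sample_sets s P \<kappa> C d p \<longleftrightarrow>
     (\<forall>n E es \<epsilon> \<phi>' w.
        connected_graph {..<n} E \<and> edge_list E es \<and> 0 < \<epsilon> \<and> \<epsilon> < 1 \<and> \<phi>' < 1 / 2 \<and>
        real \<kappa> * log 2 (real n + 2) \<le> real w \<longrightarrow>
        (let t = nat \<lfloor>C * (real (card E) + 1) * log 2 (real n + 2) ^ d\<rfloor>;
             D = run w P t (init_config n es \<epsilon> \<phi>')
         in (\<forall>c \<in> set_pmf D. halted P c) \<and>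
            measure_pmf.prob D
              {c. vertex_sample_set {..<n} E \<epsilon> \<phi>' (output_set c) \<and>
                  card (output_set c) = min (s n \<epsilon> \<phi>') n} \<ge> p))"

end

theory Submission
  imports Defs "HOL-Library.Sublist"
begin

text \<open>
  The sample is a uniformly random set of the prescribed size, so the point is a union bound that
  does not depend on \<open>n\<close>: the sides \<open>W\<close> with \<open>\<bar>N(W)\<bar> = k\<close> have only \<open>t\<^bsup>O(k)\<^esup>\<close> traces on a set \<open>S\<close>
  of \<open>t\<close> vertices. To see this, walk through \<open>S\<close> so that all vertices other than at most \<open>2t\<close> hubs
  are visited at most twice. If \<open>N(W)\<close> contains no hub, then membership in \<open>W\<close> changes at most \<open>4k\<close>
  times along the walk, so there are few traces. Otherwise guess a hub in \<open>N(W)\<close> and a vertex of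
  \<open>W \<inter> S\<close>, delete the hub and continue in the component of that vertex with \<open>k - 1\<close>.

  A ghost sample of the same size replaces the vertex set by a set of \<open>2s\<close> vertices, of which the
  sample is a random half. On a side with \<open>\<bar>W\<bar> \<ge> k / (2\<phi>')\<close> the two halves differ by a factor
  \<open>1 - \<epsilon> / 4\<close> with probability at most \<open>exp (- \<Omega>(\<epsilon>\<^sup>2 k s / (n\<phi>')))\<close>, which beats the number of
  traces for the given \<open>s\<close>. The sides that are sparse only with respect to the terminals are covered
  as well: if \<open>\<bar>W\<bar> < k / \<phi>'\<close>, then \<open>W\<close> would have to be oversampled by a factor of 9.
\<close>

section \<open>Traces of cut sides\<close>

text \<open>There can be about n^k sides with k boundary vertices, and a union bound over all of
  them costs a factor log n. The required log (n\<phi>'/\<epsilon>^3) may be far smaller, so sides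
  are told apart only on the 2s vertices of the sample and its ghost, where s is polynomial in
  n\<phi>'/\<epsilon>^3 as soon as n\<phi>' \<ge> 1. This is also why a ghost enters: the defect of
  a sample compares |W \<inter> T| with |W|, which no trace determines, whereas a comparison of two
  halves involves traces only. Hubs are the obstacle to counting traces. In a star, a walk passes
  the centre between any two leaves, so a single boundary vertex can cause any number of changes.
  Deleting it is progress because the side is connected and hence stays within one component. The
  number of traces and the tail probability are both k-th powers, so the sum over all k \<ge> 1 is a
  geometric series.\<close>

definition conn :: "'a set set \<Rightarrow> 'a set \<Rightarrow> bool" where
  "conn E W \<longleftrightarrow> (\<forall>u\<in>W. \<forall>v\<in>W. (u, v) \<in> (induced_adj E W)\<^sup>*)"

lemma induced_adj_sym: "(u, v) \<in> induced_adj E S \<longleftrightarrow> (v, u) \<in> induced_adj E S"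
  by (auto simp: induced_adj_def insert_commute)

lemma induced_adj_rtrancl_sym: "(u, v) \<in> (induced_adj E S)\<^sup>* \<Longrightarrow> (v, u) \<in> (induced_adj E S)\<^sup>*"
proof -
  have "sym ((induced_adj E S)\<^sup>*)"
    by (rule sym_rtrancl) (auto simp: sym_def induced_adj_sym)
  then show "(u, v) \<in> (induced_adj E S)\<^sup>* \<Longrightarrow> (v, u) \<in> (induced_adj E S)\<^sup>*"
    by (auto dest: symD)
qed

lemma induced_adj_mono: "S \<subseteq> S' \<Longrightarrow> induced_adj E S \<subseteq> induced_adj E S'"
  by (auto simp: induced_adj_def)

definition comp_of :: "'a set set \<Rightarrow> 'a set \<Rightarrow> 'a \<Rightarrow> 'a set" where
  "comp_of E S u = {v \<in> S. (u, v) \<in> (induced_adj E S)\<^sup>*}"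

lemma components_eq: "components E S = comp_of E S ` S"
  by (auto simp: components_def comp_of_def)

text \<open>Every prefix of a path from \<open>u\<close> ends in a vertex that \<open>u\<close>
  reaches, so a path in \<open>S\<close> that starts at \<open>u\<close> never leaves the
  component.\<close>

lemma conn_comp_of:
  assumes "u \<in> S"
  shows "conn E (comp_of E S u)"
proof -
  let ?C = "comp_of E S u"
  have *: "(u, v) \<in> (induced_adj E ?C)\<^sup>*" if "(u, v) \<in> (induced_adj E S)\<^sup>*" for v
    using that
  proof (induction rule: rtrancl_induct)
    case base then show ?case by simp
  next
    case (step y z)
    from step have "y \<in> ?C" "z \<in> ?C" "{y, z} \<in> E"
      by (auto simp: comp_of_def induced_adj_def intro: rtrancl.rtrancl_into_rtrancl)
    then have "(y, z) \<in> induced_adj E ?C" by (auto simp: induced_adj_def)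
    with step.IH show ?case by (rule rtrancl.rtrancl_into_rtrancl)
  qed
  show ?thesis
    unfolding conn_def
  proof (intro ballI)
    fix x y assume "x \<in> ?C" "y \<in> ?C"
    then have "(u, x) \<in> (induced_adj E ?C)\<^sup>*" "(u, y) \<in> (induced_adj E ?C)\<^sup>*"
      using * by (auto simp: comp_of_def)
    then show "(x, y) \<in> (induced_adj E ?C)\<^sup>*"
      by (meson induced_adj_rtrancl_sym rtrancl_trans)
  qed
qed

lemma conn_subset_comp_of:
  assumes "conn E W" "W \<subseteq> S" "u \<in> W"
  shows "W \<subseteq> comp_of E S u"
proof
  fix v assume "v \<in> W"
  with assms have "(u, v) \<in> (induced_adj E W)\<^sup>*" by (auto simp: conn_def)
  with rtrancl_mono[OF induced_adj_mono[OF assms(2), of E]] \<open>v \<in> W\<close> assms(2)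
  show "v \<in> comp_of E S u" by (auto simp: comp_of_def)
qed

lemma nbhd_comp_of: "u \<in> V - X \<Longrightarrow> nbhd V E (comp_of E (V - X) u) \<subseteq> X"
  by (auto simp: nbhd_def comp_of_def induced_adj_def intro: rtrancl.rtrancl_into_rtrancl)

lemma comp_of_disjoint_or_eq:
  "comp_of E S u = comp_of E S v \<or> comp_of E S u \<inter> comp_of E S v = {}"
  unfolding comp_of_def
  by (auto; meson induced_adj_rtrancl_sym rtrancl_trans)

lemma Union_components_Diff:
  assumes "C \<in> components E S"
  shows "\<Union> (components E S - {C}) = S - C"
proof -
  obtain u where u: "u \<in> S" "C = comp_of E S u"
    using assms by (auto simp: components_eq)
  have mem: "v \<in> comp_of E S v" if "v \<in> S" for v
    using that by (auto simp: comp_of_def)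
  have sub: "comp_of E S v \<subseteq> S" for v by (auto simp: comp_of_def)
  show ?thesis
  proof (intro equalityI subsetI)
    fix x assume "x \<in> \<Union> (components E S - {C})"
    then obtain v where "x \<in> comp_of E S v" "comp_of E S v \<noteq> C"
      by (auto simp: components_eq)
    with comp_of_disjoint_or_eq[of E S u v] sub[of v] u show "x \<in> S - C" by auto
  next
    fix x assume "x \<in> S - C"
    with mem[of x] show "x \<in> \<Union> (components E S - {C})" by (auto simp: components_eq)
  qed
qed

section \<open>Walks that revisit few vertices\<close>

text \<open>The path is stopped where it first meets \<open>U\<close> and is kept simple. Spliced
  into a walk with vertex set \<open>U\<close>, it brings in only fresh vertices, each once per
  direction.\<close>

lemma path_to_set:
  assumes "(x, y) \<in> (induced_adj E V)\<^sup>*" "y \<in> U" "x \<in> V"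
  shows "\<exists>p u. distinct p \<and> set p \<subseteq> V \<and> set p \<inter> U = {} \<and> u \<in> U \<and>
           hd (p @ [u]) = x \<and> successively (\<lambda>a b. {a, b} \<in> E) (p @ [u])"
  using assms
proof (induction rule: converse_rtrancl_induct)
  case base
  then show ?case by (intro exI[of _ "[]"] exI[of _ y]) auto
next
  case (step x z)
  show ?case
  proof (cases "x \<in> U")
    case True
    then show ?thesis by (intro exI[of _ "[]"] exI[of _ x]) auto
  next
    case False
    from step.hyps have xz: "x \<in> V" "z \<in> V" "{x, z} \<in> E" by (auto simp: induced_adj_def)
    from step.IH[OF step.prems(1) xz(2)] obtain p u where p: "distinct p" "set p \<subseteq> V"
      "set p \<inter> U = {}" "u \<in> U" "hd (p @ [u]) = z"
      "successively (\<lambda>a b. {a, b} \<in> E) (p @ [u])" by blast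
    show ?thesis
    proof (cases "x \<in> set p")
      case True
      then obtain p1 p2 where "p = p1 @ x # p2" by (auto simp: in_set_conv_decomp)
      with p show ?thesis
        by (intro exI[of _ "x # p2"] exI[of _ u]) (auto simp: successively_append_iff)
    next
      case notin: False
      with p xz False show ?thesis
        by (intro exI[of _ "x # p"] exI[of _ u]) (cases p; auto)
    qed
  qed
qed

lemma count_list_distinct: "distinct xs \<Longrightarrow> count_list xs x \<le> 1"
  by (induction xs) auto

text \<open>A new element \<open>s\<close> is attached by a detour there and back, along a simple
  path from \<open>s\<close> to the first vertex \<open>u\<close> of the old walk. The interior of
  the path is fresh and is visited exactly twice, so only \<open>s\<close> and \<open>u\<close> have
  to become hubs. In effect the walk goes around a tree spanning \<open>S\<close>, and the
  attachment points are hubs.\<close>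

lemma spanning_walk:
  assumes "conn E V" "finite S" "S \<noteq> {}" "S \<subseteq> V"
  shows "\<exists>w H. successively (\<lambda>a b. {a, b} \<in> E) w \<and> set w \<subseteq> V \<and> S \<subseteq> H \<and> H \<subseteq> set w \<and>
           card H \<le> 2 * card S \<and> (\<forall>v. v \<notin> H \<longrightarrow> count_list w v \<le> 2)"
  using assms(2-)
proof (induction rule: finite_ne_induct)
  case (singleton s)
  then show ?case by (intro exI[of _ "[s]"] exI[of _ "{s}"]) auto
next
  case (insert s S)
  then obtain w H where w: "successively (\<lambda>a b. {a, b} \<in> E) w" "set w \<subseteq> V" "S \<subseteq> H"
    "H \<subseteq> set w" "card H \<le> 2 * card S" "\<And>v. v \<notin> H \<Longrightarrow> count_list w v \<le> 2" by auto
  have finH: "finite H" using w(4) finite_subset by blast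
  obtain y where y: "y \<in> set w" using insert.hyps w(3,4) by blast
  have "(s, y) \<in> (induced_adj E V)\<^sup>*" using assms(1) y w(2) insert.prems by (auto simp: conn_def)
  from path_to_set[OF this y] insert.prems obtain p u where p: "distinct p" "set p \<subseteq> V"
    "set p \<inter> set w = {}" "u \<in> set w" "hd (p @ [u]) = s"
    "successively (\<lambda>a b. {a, b} \<in> E) (p @ [u])" by auto
  have card': "card (insert s (insert u H)) \<le> 2 * card (insert s S)"
    using w(5) insert.hyps finH card_insert_le_m1[of "2 * card S + 1"]
    by (simp add: card_insert_if)
  show ?case
  proof (cases p)
    case Nil
    then have "s = u" using p by auto
    have "card (insert s H) \<le> 2 * card (insert s S)"
      using card' \<open>s = u\<close> by simp
    with w Nil \<open>s = u\<close> p show ?thesis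
      by (intro exI[of _ w] exI[of _ "insert s H"]) auto
  next
    case (Cons s' p')
    with p have p': "p = s # p'" by auto
    obtain w1 w2 where ww: "w = w1 @ u # w2" using p(4) by (auto simp: in_set_conv_decomp)
    let ?w = "w1 @ (u # rev (s # p')) @ (p' @ u # w2)"
    have rv: "successively (\<lambda>a b. {a, b} \<in> E) (u # rev (s # p'))"
    proof -
      have "successively (\<lambda>a b. {b, a} \<in> E) (p @ [u])"
        using p(6) by (simp add: insert_commute)
      then have "successively (\<lambda>a b. {a, b} \<in> E) (rev (p @ [u]))"
        by (simp only: successively_rev)
      then show ?thesis by (simp add: p')
    qed
    have a: "successively (\<lambda>a b. {a, b} \<in> E) w1" "w1 \<noteq> [] \<Longrightarrow> {last w1, u} \<in> E"
      "successively (\<lambda>a b. {a, b} \<in> E) (u # w2)"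
      using w(1) by (auto simp: ww successively_append_iff)
    have b: "successively (\<lambda>a b. {a, b} \<in> E) ((p' @ [u]) @ w2)"
    proof -
      have "successively (\<lambda>a b. {a, b} \<in> E) (p' @ [u])"
        using p(6) by (simp add: p' successively_Cons)
      then show ?thesis using a(3) by (subst successively_append_iff) (auto simp: successively_Cons)
    qed
    have c: "{s, hd (p' @ u # w2)} \<in> E" using p(6) by (cases p') (auto simp: p')
    have "successively (\<lambda>a b. {a, b} \<in> E) ((u # rev (s # p')) @ (p' @ u # w2))"
      using rv b c by (subst successively_append_iff) auto
    then have "successively (\<lambda>a b. {a, b} \<in> E) ?w"
      using a by (subst successively_append_iff) auto
    moreover have "count_list ?w v \<le> 2" if "v \<notin> insert s (insert u H)" for v
    proof (cases "v \<in> set p'")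
      case True
      then have "v \<notin> set w" using p(3) by (auto simp: p')
      moreover have "count_list p' v \<le> 1"
        using p(1) by (intro count_list_distinct) (simp add: p')
      moreover have "v \<noteq> u" "v \<noteq> s" using that by auto
      ultimately show ?thesis by (auto simp: ww)
    next
      case False
      then show ?thesis using w(6)[of v] that by (auto simp: ww)
    qed
    moreover have "set ?w \<subseteq> V" "insert s (insert u H) \<subseteq> set ?w" "insert s S \<subseteq> insert s (insert u H)"
      using w p by (auto simp: ww p')
    ultimately show ?thesis using card'
      by (intro exI[of _ ?w] exI[of _ "insert s (insert u H)"]) auto
  qed
qed

section \<open>Binary words with few changes\<close>

fun changes :: "bool list \<Rightarrow> nat" where
  "changes (a # b # xs) = (if a = b then 0 else 1) + changes (b # xs)"
| "changes _ = 0"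

lemma changes_Cons: "changes xs \<le> changes (x # xs)"
  by (cases xs) auto

lemma changes_Cons_skip: "changes (z # xs) \<le> changes (z # x # xs)"
  by (cases xs) auto

text \<open>Deleting an entry merges two adjacent comparisons into one, which cannot add a change.
  The entry \<open>z\<close> in front is carried along so that the induction sees both neighbours of
  a deleted entry.\<close>

lemma changes_subseq_Cons: "subseq ys xs \<Longrightarrow> changes (z # ys) \<le> changes (z # xs)"
proof (induction arbitrary: z rule: list_emb.induct)
  case (list_emb_Nil ys)
  then show ?case by (cases ys) auto
next
  case (list_emb_Cons xs ys y)
  then show ?case using changes_Cons_skip le_trans by blast
next
  case (list_emb_Cons2 x y xs ys)
  then show ?case by auto
qed

lemma changes_subseq: "subseq ys xs \<Longrightarrow> changes ys \<le> changes xs"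
proof (induction rule: list_emb.induct)
  case (list_emb_Nil ys)
  then show ?case by simp
next
  case (list_emb_Cons xs ys y)
  then show ?case using changes_Cons le_trans by blast
next
  case (list_emb_Cons2 x y xs ys)
  then show ?case using changes_subseq_Cons by auto
qed

lemma subseq_remdups: "subseq (remdups xs) xs"
  by (induction xs) auto

text \<open>A word is extended at the front: repeating its head keeps the number of changes,
  negating it uses one up. This is the recurrence A(t+1, j) \<le> A(t, j) + A(t, j-1).\<close>

lemma card_few_changes:
  assumes "t \<ge> 1"
  shows "card {bs. length bs = t \<and> changes bs \<le> j} \<le> 2 * t ^ j"
  using assms
proof (induction t arbitrary: j rule: dec_induct)
  case base
  have "{bs. length bs = 1 \<and> changes bs \<le> j} \<subseteq> {[True], [False]}"
  proof
    fix bs :: "bool list" assume "bs \<in> {bs. length bs = 1 \<and> changes bs \<le> j}"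
    then have "length bs = Suc 0" by auto
    then show "bs \<in> {[True], [False]}" by (auto simp: length_Suc_conv)
  qed
  from card_mono[OF _ this] show ?case by simp
next
  case (step t)
  let ?A = "\<lambda>t j. {bs. length bs = t \<and> changes bs \<le> j}"
  have fin: "finite (?A t j)" for t j
    by (rule finite_subset[OF _ finite_lists_length_eq[OF finite[of UNIV], of t]]) auto
  show ?case
  proof (cases j)
    case 0
    have "?A (Suc t) j \<subseteq> (\<lambda>bs. hd bs # bs) ` ?A t j"
    proof
      fix bs assume bs: "bs \<in> ?A (Suc t) j"
      then obtain a b r where "bs = a # b # r"
        using step.hyps by (auto simp: length_Suc_conv Suc_le_eq gr0_conv_Suc)
      with bs 0 show "bs \<in> (\<lambda>bs. hd bs # bs) ` ?A t j"
        by (intro image_eqI[of _ _ "b # r"]) (auto split: if_splits)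
    qed
    then have "card (?A (Suc t) j) \<le> card (?A t j)" using fin by (rule surj_card_le[rotated])
    with step.IH[of j] 0 show ?thesis by simp
  next
    case (Suc i)
    have "?A (Suc t) j \<subseteq> (\<lambda>bs. hd bs # bs) ` ?A t j \<union> (\<lambda>bs. (\<not> hd bs) # bs) ` ?A t i"
    proof
      fix bs assume bs: "bs \<in> ?A (Suc t) j"
      then obtain a b r where r: "bs = a # b # r"
        using step.hyps by (auto simp: length_Suc_conv Suc_le_eq gr0_conv_Suc)
      show "bs \<in> (\<lambda>bs. hd bs # bs) ` ?A t j \<union> (\<lambda>bs. (\<not> hd bs) # bs) ` ?A t i"
      proof (cases "a = b")
        case True
        with r bs show ?thesis by (intro UnI1 image_eqI[of _ _ "b # r"]) auto
      next
        case False
        with r bs Suc show ?thesis by (intro UnI2 image_eqI[of _ _ "b # r"]) auto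
      qed
    qed
    then have "card (?A (Suc t) j) \<le>
        card ((\<lambda>bs. hd bs # bs) ` ?A t j \<union> (\<lambda>bs. (\<not> hd bs) # bs) ` ?A t i)"
      using fin by (intro card_mono) auto
    also have "\<dots> \<le> card (?A t j) + card (?A t i)"
      by (rule order_trans[OF card_Un_le]) (intro add_mono card_image_le fin)
    also have "\<dots> \<le> 2 * t ^ j + 2 * t ^ i" using step.IH by (intro add_mono)
    also have "\<dots> = 2 * (t + 1) * t ^ i" by (simp add: Suc algebra_simps)
    also have "\<dots> \<le> 2 * (t + 1) * (t + 1) ^ i" by (intro mult_left_mono power_mono) auto
    finally show ?thesis by (simp add: Suc algebra_simps)
  qed
qed

text \<open>Where membership changes, the endpoint outside \<open>W\<close> lies in the boundary,
  and a visit to the boundary takes part in at most two steps of the walk. The extra 1 for a head in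
  \<open>X\<close> is a charge not yet spent: it pays for the step into this head when the walk is
  extended at the front.\<close>

lemma changes_le_boundary:
  assumes "successively (\<lambda>a b. {a, b} \<in> E) w" "set w \<subseteq> V" "nbhd V E W \<subseteq> X"
  shows "changes (map (\<lambda>v. v \<in> W) w) + (if w \<noteq> [] \<and> hd w \<in> X then 1 else 0)
           \<le> 2 * length (filter (\<lambda>v. v \<in> X) w)"
  using assms(1,2)
proof (induction w rule: induct_list012)
  case (3 a b r)
  have "a \<in> X \<or> b \<in> X" if "(a \<in> W) \<noteq> (b \<in> W)"
  proof -
    have ab: "{a, b} \<in> E" "{b, a} \<in> E" "a \<in> V" "b \<in> V"
      using 3(3,4) by (auto simp: insert_commute)
    with that assms(3) show ?thesis by (auto simp: nbhd_def)
  qed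
  with 3(2-) show ?case by auto
qed auto

lemma length_filter_eq_sum_count_list:
  "finite X \<Longrightarrow> length (filter (\<lambda>v. v \<in> X) w) = (\<Sum>x\<in>X. count_list w x)"
proof (induction w)
  case (Cons a w)
  have "(\<Sum>x\<in>X. count_list (a # w) x) = (\<Sum>x\<in>X. (if x = a then 1 else 0) + count_list w x)"
    by (intro sum.cong) auto
  also have "\<dots> = (if a \<in> X then 1 else 0) + (\<Sum>x\<in>X. count_list w x)"
    using Cons.prems by (simp add: sum.distrib)
  finally show ?case using Cons by auto
qed auto

text \<open>At most k boundary vertices, none of them a hub, are met at most 2k times, which allows
  4k changes. With \<open>S\<close> listed in the order of the walk, the trace becomes a subsequence
  of the membership word.\<close>

lemma card_traces_avoiding_hubs:
  assumes "finite V" "successively (\<lambda>a b. {a, b} \<in> E) w" "set w \<subseteq> V" "S \<subseteq> H" "H \<subseteq> set w"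
    "\<And>v. v \<notin> H \<Longrightarrow> count_list w v \<le> 2" "S \<noteq> {}"
  shows "card {W \<inter> S |W. W \<subseteq> V \<and> card (nbhd V E W) \<le> k \<and> nbhd V E W \<inter> H = {}}
           \<le> 2 * card S ^ (4 * k)"
proof -
  define ys where "ys = filter (\<lambda>v. v \<in> S) (remdups w)"
  have sub: "subseq ys w"
    unfolding ys_def
    by (rule subseq_order.trans[OF subseq_filter_left subseq_remdups])
  have ys: "set ys = S" "distinct ys" using assms(4,5) by (auto simp: ys_def)
  then have len: "length ys = card S" by (metis distinct_card)
  have finS: "finite S" using ys by auto
  let ?D = "{bs. length bs = card S \<and> changes bs \<le> 4 * k}"
  let ?g = "\<lambda>bs. {v. \<exists>i < length ys. v = ys ! i \<and> bs ! i}"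
  have finD: "finite ?D"
    by (rule finite_subset[OF _ finite_lists_length_eq[OF finite[of UNIV], of "card S"]]) auto
  have "{W \<inter> S |W. W \<subseteq> V \<and> card (nbhd V E W) \<le> k \<and> nbhd V E W \<inter> H = {}} \<subseteq> ?g ` ?D"
  proof clarify
    fix W assume W: "W \<subseteq> V" "card (nbhd V E W) \<le> k" "nbhd V E W \<inter> H = {}"
    let ?X = "nbhd V E W"
    have finX: "finite ?X" using assms(1) by (auto simp: nbhd_def)
    have "changes (map (\<lambda>v. v \<in> W) ys) \<le> changes (map (\<lambda>v. v \<in> W) w)"
      by (intro changes_subseq subseq_map sub)
    also have "\<dots> \<le> 2 * length (filter (\<lambda>v. v \<in> ?X) w)"
      using changes_le_boundary[OF assms(2,3), of W ?X] by auto
    also have "\<dots> = 2 * (\<Sum>x\<in>?X. count_list w x)"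
      using finX by (simp add: length_filter_eq_sum_count_list)
    also have "\<dots> \<le> 2 * (\<Sum>x\<in>?X. 2)"
      using W(3) assms(6) by (intro mult_left_mono sum_mono) auto
    also have "\<dots> \<le> 4 * k" using W(2) by simp
    finally have "map (\<lambda>v. v \<in> W) ys \<in> ?D" using len by simp
    moreover have "W \<inter> S = ?g (map (\<lambda>v. v \<in> W) ys)"
      unfolding ys(1)[symmetric] by (fastforce simp: in_set_conv_nth)
    ultimately show "W \<inter> S \<in> ?g ` ?D" by (intro image_eqI)
  qed
  from surj_card_le[OF finD this] show ?thesis
    by (rule order_trans) (use finS assms(7) in \<open>simp add: card_few_changes Suc_le_eq card_gt_0_iff\<close>)
qed

section \<open>Traces of connected sets with a small boundary\<close>

text \<open>At most \<open>k\<close> rather than exactly \<open>k\<close>, because restricting to a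
  component may remove further boundary vertices besides the deleted hub.\<close>

definition few_boundary :: "'a set \<Rightarrow> 'a set set \<Rightarrow> nat \<Rightarrow> 'a set set" where
  "few_boundary V E k = {W. W \<subseteq> V \<and> conn E W \<and> card (nbhd V E W) \<le> k}"

text \<open>Relative to the component of \<open>V - {h}\<close> that contains it, \<open>W\<close>
  has lost the boundary vertex \<open>h\<close> and gained none. The at most 2t * t guesses give
  f(k+1) \<le> 1 + 2 t^(4(k+1)) + 2 t^2 f(k). The bound \<open>t\<close> stays fixed while
  \<open>V\<close> and \<open>S\<close> shrink.\<close>

lemma card_traces_few_boundary:
  assumes "finite V" "conn E V" "S \<subseteq> V" "card S \<le> t" "t \<ge> 1"
  shows "card ((\<lambda>W. W \<inter> S) ` few_boundary V E k) \<le> 3 * (4 * t ^ 4) ^ k"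
  using assms(1-4)
proof (induction k arbitrary: V S)
  case (0 V S)
  show ?case
  proof (cases "S = {}")
    case True
    then have "(\<lambda>W. W \<inter> S) ` few_boundary V E 0 \<subseteq> {{}}" by auto
    from card_mono[OF _ this] show ?thesis by simp
  next
    case False
    have finS: "finite S" using 0 finite_subset by blast
    obtain w H where w: "successively (\<lambda>a b. {a, b} \<in> E) w" "set w \<subseteq> V" "S \<subseteq> H"
      "H \<subseteq> set w" "card H \<le> 2 * card S" "\<And>v. v \<notin> H \<Longrightarrow> count_list w v \<le> 2"
      using spanning_walk[OF 0(2) finS False 0(3)] by blast
    let ?A = "{W \<inter> S |W. W \<subseteq> V \<and> card (nbhd V E W) \<le> 0 \<and> nbhd V E W \<inter> H = {}}"
    have "finite (nbhd V E W)" for W using 0(1) by (auto simp: nbhd_def)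
    then have "(\<lambda>W. W \<inter> S) ` few_boundary V E 0 \<subseteq> ?A"
      by (fastforce simp: few_boundary_def)
    moreover have "finite ?A"
      by (rule finite_subset[of _ "Pow S"]) (use finS in auto)
    ultimately have "card ((\<lambda>W. W \<inter> S) ` few_boundary V E 0) \<le> card ?A" by (rule card_mono[rotated])
    also have "\<dots> \<le> 2 * card S ^ (4 * 0)"
      by (rule card_traces_avoiding_hubs[OF 0(1) w(1-4) w(6) False])
    finally show ?thesis by simp
  qed
next
  case (Suc k V S)
  show ?case
  proof (cases "S = {}")
    case True
    then have "(\<lambda>W. W \<inter> S) ` few_boundary V E (Suc k) \<subseteq> {{}}" by auto
    from card_mono[OF _ this] have "card ((\<lambda>W. W \<inter> S) ` few_boundary V E (Suc k)) \<le> 1" by simp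
    also have "1 \<le> 3 * (4 * t ^ 4) ^ Suc k" using assms(5) by simp
    finally show ?thesis .
  next
    case False
    have finS: "finite S" using Suc.prems finite_subset by blast
    obtain w H where w: "successively (\<lambda>a b. {a, b} \<in> E) w" "set w \<subseteq> V" "S \<subseteq> H"
      "H \<subseteq> set w" "card H \<le> 2 * card S" "\<And>v. v \<notin> H \<Longrightarrow> count_list w v \<le> 2"
      using spanning_walk[OF Suc.prems(2) finS False Suc.prems(3)] by blast
    have finH: "finite H" using w(4) finite_subset by blast
    define P where "P = {(h, s). h \<in> H \<and> s \<in> S \<and> s \<noteq> h}"
    define V' where "V' = (\<lambda>(h, s). comp_of E (V - {h}) s)"
    let ?A = "{W \<inter> S |W. W \<subseteq> V \<and> card (nbhd V E W) \<le> Suc k \<and> nbhd V E W \<inter> H = {}}"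
    let ?B = "\<lambda>p. (\<lambda>W. W \<inter> (S \<inter> V' p)) ` few_boundary (V' p) E k"
    have finP: "finite P" and cardP: "card P \<le> 2 * t * t"
    proof -
      have *: "P \<subseteq> H \<times> S" by (auto simp: P_def)
      then show "finite P" using finH finS by (meson finite_SigmaI finite_subset)
      have "card P \<le> card (H \<times> S)" using * finH finS by (intro card_mono) auto
      also have "\<dots> = card H * card S" by (rule card_cartesian_product)
      also have "\<dots> \<le> (2 * t) * t" using w(5) Suc.prems(4) by (intro mult_mono) auto
      finally show "card P \<le> 2 * t * t" .
    qed
    have finA: "finite ?A"
      by (rule finite_subset[of _ "Pow S"]) (use finS in auto)
    have finB: "finite (?B p)" for p
      by (rule finite_subset[of _ "Pow S"]) (use finS in auto)
    have cover: "(\<lambda>W. W \<inter> S) ` few_boundary V E (Suc k) \<subseteq> {{}} \<union> ?A \<union> (\<Union>p\<in>P. ?B p)"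
    proof (intro image_subsetI)
      fix W assume W: "W \<in> few_boundary V E (Suc k)"
      show "W \<inter> S \<in> {{}} \<union> ?A \<union> (\<Union>p\<in>P. ?B p)"
      proof (rule ccontr)
        assume not: "W \<inter> S \<notin> {{}} \<union> ?A \<union> (\<Union>p\<in>P. ?B p)"
        then have "W \<inter> S \<noteq> {}" by blast
        from not have notA: "nbhd V E W \<inter> H \<noteq> {}"
          using W by (auto simp: few_boundary_def)
        obtain s where s: "s \<in> W" "s \<in> S" using \<open>W \<inter> S \<noteq> {}\<close> by auto
        from notA obtain h where h: "h \<in> nbhd V E W" "h \<in> H" by blast
        have hW: "h \<notin> W" "h \<in> V" using h by (auto simp: nbhd_def)
        with s h have pP: "(h, s) \<in> P" by (auto simp: P_def)
        have WV': "W \<subseteq> V' (h, s)"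
          unfolding V'_def using W hW s by (simp, intro conn_subset_comp_of) (auto simp: few_boundary_def)
        have "nbhd (V' (h, s)) E W \<subseteq> nbhd V E W - {h}"
          by (auto simp: nbhd_def V'_def comp_of_def)
        moreover have "finite (nbhd V E W)" using Suc.prems(1) by (auto simp: nbhd_def)
        ultimately have "card (nbhd (V' (h, s)) E W) \<le> card (nbhd V E W - {h})"
          by (intro card_mono) auto
        also have "\<dots> \<le> k" using h W by (auto simp: few_boundary_def)
        finally have "W \<in> few_boundary (V' (h, s)) E k" using W WV' by (auto simp: few_boundary_def)
        moreover have "W \<inter> S = W \<inter> (S \<inter> V' (h, s))" using WV' by auto
        ultimately have "W \<inter> S \<in> ?B (h, s)" by auto
        with not pP show False by blast
      qed
    qed
    have B: "card (?B p) \<le> 3 * (4 * t ^ 4) ^ k" if "p \<in> P" for p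
    proof -
      obtain h s where p: "p = (h, s)" by (cases p)
      have s: "s \<in> V - {h}" using that Suc.prems(3) by (auto simp: P_def p)
      have fin: "finite (V' p)" using Suc.prems(1) by (simp add: V'_def p comp_of_def)
      have "card (S \<inter> V' p) \<le> card S" using finS by (intro card_mono) auto
      then have "card (S \<inter> V' p) \<le> t" using Suc.prems(4) by simp
      then show ?thesis using conn_comp_of[OF s] fin by (intro Suc.IH) (auto simp: V'_def p)
    qed
    have "card ((\<lambda>W. W \<inter> S) ` few_boundary V E (Suc k)) \<le> card ({{}} \<union> ?A \<union> (\<Union>p\<in>P. ?B p))"
      using cover finA finB finP by (intro card_mono) auto
    also have "\<dots> \<le> 1 + card ?A + card (\<Union>p\<in>P. ?B p)"
      by (rule order_trans[OF card_Un_le], rule add_mono, rule order_trans[OF card_Un_le]) auto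
    also have "card ?A \<le> 2 * card S ^ (4 * Suc k)"
      by (rule card_traces_avoiding_hubs[OF Suc.prems(1) w(1-4) w(6) False])
    also have "\<dots> \<le> 2 * t ^ (4 * Suc k)"
      using Suc.prems(4) by (intro mult_left_mono power_mono) auto
    also have "card (\<Union>p\<in>P. ?B p) \<le> (\<Sum>p\<in>P. card (?B p))"
      using finP by (rule card_UN_le)
    also have "\<dots> \<le> card P * (3 * (4 * t ^ 4) ^ k)"
      using sum_bounded_above[OF B, of P "\<lambda>p. p"] by simp
    also have "\<dots> \<le> (2 * t * t) * (3 * (4 * t ^ 4) ^ k)"
      using cardP by (intro mult_right_mono) auto
    finally have *: "card ((\<lambda>W. W \<inter> S) ` few_boundary V E (Suc k)) \<le>
        1 + 2 * t ^ (4 * Suc k) + (2 * t * t) * (3 * (4 * t ^ 4) ^ k)" by simp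
    \<comment> \<open>In these terms the bound is at most 1 + 2a + 6q. As 1 \<le> a \<le> q, this is
      at most 9q, below the required 12q.\<close>
    define a q where "a = t ^ 4 * (t ^ 4) ^ k" and "q = t ^ 4 * (4 * t ^ 4) ^ k"
    have "t * t \<le> t ^ 4" using power_increasing[of 2 4 t] assms(5) by (simp add: power2_eq_square)
    then have "(2 * t * t) * (3 * (4 * t ^ 4) ^ k) \<le> (2 * t ^ 4) * (3 * (4 * t ^ 4) ^ k)"
      by (intro mult_right_mono) auto
    also have "\<dots> = 6 * q" by (simp add: q_def)
    finally have 1: "(2 * t * t) * (3 * (4 * t ^ 4) ^ k) \<le> 6 * q" .
    have 2: "1 \<le> a" using assms(5) by (simp add: a_def)
    have 3: "t ^ (4 * Suc k) = a" by (simp add: a_def power_add power_mult)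
    have 4: "a \<le> q" unfolding a_def q_def by (intro mult_left_mono power_mono) auto
    have 5: "3 * (4 * t ^ 4) ^ Suc k = 12 * q" by (simp add: q_def)
    show ?thesis using * 1 2 4 unfolding 3 5 by linarith
  qed
qed

text \<open>A nonempty set consists of one element and a smaller set; \<open>None\<close> stands for
  adding nothing, which accounts for the 1 in the base.\<close>

lemma card_subsets_card_le:
  assumes "finite S"
  shows "card {Y. Y \<subseteq> S \<and> card Y \<le> k} \<le> (card S + 1) ^ k"
proof (induction k)
  case 0
  have "{Y. Y \<subseteq> S \<and> card Y \<le> 0} \<subseteq> {{}}" using assms by (auto dest: finite_subset)
  from card_mono[OF _ this] show ?case by simp
next
  case (Suc k)
  let ?f = "\<lambda>(x, Y). set_option x \<union> Y"
  let ?D = "(insert None (Some ` S)) \<times> {Y. Y \<subseteq> S \<and> card Y \<le> k}"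
  have fin: "finite {Y. Y \<subseteq> S \<and> card Y \<le> k}"
    by (rule finite_subset[of _ "Pow S"]) (use assms in auto)
  have "{Y. Y \<subseteq> S \<and> card Y \<le> Suc k} \<subseteq> ?f ` ?D"
  proof
    fix Y assume Y: "Y \<in> {Y. Y \<subseteq> S \<and> card Y \<le> Suc k}"
    show "Y \<in> ?f ` ?D"
    proof (cases "Y = {}")
      case True
      then show ?thesis by (intro image_eqI[of _ _ "(None, {})"]) auto
    next
      case False
      then obtain y where y: "y \<in> Y" by auto
      have "finite Y" using Y assms finite_subset by auto
      with y Y show ?thesis by (intro image_eqI[of _ _ "(Some y, Y - {y})"]) auto
    qed
  qed
  then have "card {Y. Y \<subseteq> S \<and> card Y \<le> Suc k} \<le> card ?D"
    using fin assms by (intro surj_card_le) auto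
  also have "\<dots> = (card S + 1) * card {Y. Y \<subseteq> S \<and> card Y \<le> k}"
    using assms by (simp add: card_cartesian_product card_image)
  also have "\<dots> \<le> (card S + 1) * (card S + 1) ^ k" using Suc by (rule mult_left_mono) auto
  finally show ?case by simp
qed

section \<open>Traces of both kinds of cut sides\<close>

definition cut_sides :: "'a set \<Rightarrow> 'a set set \<Rightarrow> nat \<Rightarrow> 'a set set" where
  "cut_sides V E k = {W. W \<subseteq> V \<and> cut_side V E W \<and> card (nbhd V E W) = k}"

text \<open>A union of components need not be connected, but omitting only one component leaves the
  complement of the boundary and of a connected set \<open>C\<close>. The trace is then determined
  by those of \<open>C\<close> and of the boundary, and both sets have a small boundary or a small
  size.\<close>

lemma cut_side_cases:
  assumes "cut_side V E W"
  obtains "conn E W"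
    | C where "C \<subseteq> V" "conn E C" "nbhd V E C \<subseteq> nbhd V E W" "W = V - nbhd V E W - C"
proof -
  let ?X = "nbhd V E W"
  from assms consider "W \<in> components E (V - ?X)"
    | C where "C \<in> components E (V - ?X)" "W = \<Union> (components E (V - ?X) - {C})"
    by (auto simp: cut_side_def)
  then show ?thesis
  proof cases
    case 1
    then obtain u where "u \<in> V - ?X" "W = comp_of E (V - ?X) u" by (auto simp: components_eq)
    then show ?thesis using that(1) conn_comp_of by metis
  next
    case 2
    then obtain u where u: "u \<in> V - ?X" "C = comp_of E (V - ?X) u" by (auto simp: components_eq)
    show ?thesis
    proof (rule that(2))
      show "W = V - ?X - C" using Union_components_Diff[OF 2(1)] 2(2) by simp
      show "C \<subseteq> V" using u(2) by (auto simp: comp_of_def)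
      show "conn E C" using conn_comp_of[OF u(1)] u(2) by simp
      show "nbhd V E C \<subseteq> ?X" using nbhd_comp_of[OF u(1)] u(2) by simp
    qed
  qed
qed

lemma card_traces_cut_sides:
  assumes "finite V" "conn E V" "S \<subseteq> V" "card S \<le> t" "t \<ge> 1" "k \<ge> 1"
  shows "card ((\<lambda>W. W \<inter> S) ` cut_sides V E k) \<le> (48 * t ^ 5) ^ k"
proof -
  let ?T = "(\<lambda>W. W \<inter> S) ` few_boundary V E k"
  let ?Y = "{Y. Y \<subseteq> S \<and> card Y \<le> k}"
  let ?f = "\<lambda>(A, Y). S - Y - A"
  have finS: "finite S" using assms finite_subset by blast
  have finT: "finite ?T" by (rule finite_subset[of _ "Pow S"]) (use finS in auto)
  have finY: "finite ?Y" by (rule finite_subset[of _ "Pow S"]) (use finS in auto)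
  have finN: "finite (nbhd V E W)" for W using assms(1) by (auto simp: nbhd_def)
  have "(\<lambda>W. W \<inter> S) ` cut_sides V E k \<subseteq> ?T \<union> ?f ` (?T \<times> ?Y)"
  proof clarify
    fix W assume W: "W \<in> cut_sides V E k" and not: "W \<inter> S \<notin> ?f ` (?T \<times> ?Y)"
    from W have W': "W \<subseteq> V" "card (nbhd V E W) = k" "cut_side V E W"
      by (auto simp: cut_sides_def)
    from W'(3) show "W \<inter> S \<in> ?T"
    proof (cases rule: cut_side_cases)
      case 1
      with W' show ?thesis by (auto simp: few_boundary_def)
    next
      case (2 C)
      have "card (nbhd V E C) \<le> k" using card_mono[OF finN 2(3)] W'(2) by simp
      with 2(1,2) have "C \<in> few_boundary V E k" by (auto simp: few_boundary_def)
      moreover have "card (nbhd V E W \<inter> S) \<le> k"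
        using card_mono[OF finN, of "nbhd V E W \<inter> S" W] W'(2) by simp
      moreover have "W \<inter> S = S - (nbhd V E W \<inter> S) - (C \<inter> S)"
        using arg_cong[OF 2(4), of "\<lambda>A. A \<inter> S"] assms(3) by blast
      ultimately have "W \<inter> S \<in> ?f ` (?T \<times> ?Y)"
        by (intro image_eqI[of _ _ "(C \<inter> S, nbhd V E W \<inter> S)"]) auto
      with not show ?thesis by contradiction
    qed
  qed
  then have "card ((\<lambda>W. W \<inter> S) ` cut_sides V E k) \<le> card (?T \<union> ?f ` (?T \<times> ?Y))"
    using finT finY by (intro card_mono) auto
  also have "\<dots> \<le> card ?T + card (?T \<times> ?Y)"
    by (rule order_trans[OF card_Un_le]) (intro add_mono card_image_le finite_SigmaI finT finY order_refl)
  also have "\<dots> = card ?T * (1 + card ?Y)" by (simp add: card_cartesian_product)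
  also have "\<dots> \<le> (3 * (4 * t ^ 4) ^ k) * (1 + (2 * t) ^ k)"
  proof (intro mult_mono add_mono)
    have "card ?Y \<le> (card S + 1) ^ k" by (rule card_subsets_card_le[OF finS])
    also have "\<dots> \<le> (2 * t) ^ k" using assms(4,5) by (intro power_mono) auto
    finally show "card ?Y \<le> (2 * t) ^ k" .
  qed (rule card_traces_few_boundary[OF assms(1-5)], simp_all)
  also have "\<dots> \<le> (3 * (4 * t ^ 4) ^ k) * (2 * (2 * t) ^ k)"
    using assms(5) by (intro mult_left_mono) auto
  also have "\<dots> = 6 * ((4 * t ^ 4) ^ k * (2 * t) ^ k)" by simp
  also have "(4 * t ^ 4) ^ k * (2 * t) ^ k = (8 * t ^ 5) ^ k"
  proof -
    have "4 * t ^ 4 * (2 * t) = 8 * t ^ 5" by (simp add: power_numeral_reduce)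
    then show ?thesis by (simp only: power_mult_distrib[symmetric])
  qed
  \<comment> \<open>Here \<open>k \<ge> 1\<close> enters: the constant moves into the k-th power, so
    that the later union bound becomes a geometric series.\<close>
  also have "6 * (8 * t ^ 5) ^ k \<le> 6 ^ k * (8 * t ^ 5) ^ k"
    using assms(6) self_le_power[of "6::nat" k] by (intro mult_right_mono) auto
  also have "\<dots> = (6 * (8 * t ^ 5)) ^ k" by (rule power_mult_distrib[symmetric])
  also have "\<dots> = (48 * t ^ 5) ^ k" by simp
  finally show ?thesis .
qed

section \<open>Sampling without replacement\<close>

text \<open>Uniform samples are treated by counting: a probability is a cardinality divided by a
  binomial coefficient. Probability mass functions appear only with the program.\<close>

definition nsub :: "'a set \<Rightarrow> nat \<Rightarrow> 'a set set" where
  "nsub R m = {T. T \<subseteq> R \<and> card T = m}"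

lemma finite_nsub: "finite R \<Longrightarrow> finite (nsub R m)"
  by (simp add: nsub_def)

lemma card_nsub: "finite R \<Longrightarrow> card (nsub R m) = card R choose m"
  by (simp add: nsub_def n_subsets)

lemma card_nsub_insert:
  assumes "finite R" "x \<in> R" "x \<notin> J"
  shows "card {T \<in> nsub R (Suc m). insert x J \<subseteq> T} = card {T \<in> nsub (R - {x}) m. J \<subseteq> T}"
proof (rule sym, rule bij_betw_same_card[of "insert x"])
  show "bij_betw (insert x) {T \<in> nsub (R - {x}) m. J \<subseteq> T} {T \<in> nsub R (Suc m). insert x J \<subseteq> T}"
  proof (rule bij_betwI[where g = "\<lambda>T. T - {x}"])
    show "insert x \<in> {T \<in> nsub (R - {x}) m. J \<subseteq> T} \<rightarrow> {T \<in> nsub R (Suc m). insert x J \<subseteq> T}"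
    proof
      fix T assume T: "T \<in> {T \<in> nsub (R - {x}) m. J \<subseteq> T}"
      then have "finite T" "x \<notin> T" using assms(1) by (auto simp: nsub_def intro: finite_subset)
      with T assms show "insert x T \<in> {T \<in> nsub R (Suc m). insert x J \<subseteq> T}"
        by (auto simp: nsub_def)
    qed
    show "(\<lambda>T. T - {x}) \<in> {T \<in> nsub R (Suc m). insert x J \<subseteq> T} \<rightarrow> {T \<in> nsub (R - {x}) m. J \<subseteq> T}"
      using assms by (auto simp: nsub_def)
  qed (auto simp: nsub_def)
qed

lemma binomial_Suc_Suc_real:
  assumes "m < N"
  shows "real ((N - 1) choose m) = real (N choose Suc m) * (real (Suc m) / real N)"
proof -
  have "Suc m * (N choose Suc m) = N * ((N - 1) choose m)"
    using times_binomial_minus1_eq[of "Suc m" N] by simp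
  then have "real (Suc m) * real (N choose Suc m) = real N * real ((N - 1) choose m)"
    by (metis of_nat_mult)
  then show ?thesis using assms by (simp add: field_simps)
qed

lemma card_nsub_member:
  assumes "finite R" "x \<in> R" "m \<le> card R"
  shows "real (card {T \<in> nsub R m. x \<in> T}) = real (card R choose m) * (real m / real (card R))"
proof (cases m)
  case 0
  have *: "{T \<in> nsub R 0. x \<in> T} = {}" using assms(1) by (auto simp: nsub_def dest: finite_subset)
  then show ?thesis unfolding 0 * by simp
next
  case (Suc m')
  have "card {T \<in> nsub R m. x \<in> T} = card (nsub (R - {x}) m')"
    using card_nsub_insert[OF assms(1,2), of "{}" m'] Suc by simp
  also have "\<dots> = (card R - 1) choose m'" using assms by (simp add: card_nsub)
  finally show ?thesis using binomial_Suc_Suc_real[of m' "card R"] assms(3) Suc by simp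
qed

text \<open>Inclusions are negatively correlated: once \<open>x\<close> is in the sample, another
  element is included with probability (m-1)/(N-1), which is at most m/N.\<close>

lemma card_nsub_supset:
  assumes "finite J" "finite R" "J \<subseteq> R" "m \<le> card R"
  shows "real (card {T \<in> nsub R m. J \<subseteq> T})
           \<le> real (card R choose m) * (real m / real (card R)) ^ card J"
  using assms
proof (induction J arbitrary: R m rule: finite_induct)
  case empty
  then show ?case by (simp add: card_nsub)
next
  case (insert x J)
  show ?case
  proof (cases m)
    case 0
    have *: "{T \<in> nsub R 0. insert x J \<subseteq> T} = {}"
      using insert.prems by (auto simp: nsub_def dest: finite_subset)
    then show ?thesis unfolding 0 * by simp
  next
    case (Suc m')
    let ?N = "card R"
    have N: "card (R - {x}) = ?N - 1" "m' \<le> ?N - 1" using insert.prems Suc by auto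
    have "card {T \<in> nsub R m. insert x J \<subseteq> T} = card {T \<in> nsub (R - {x}) m'. J \<subseteq> T}"
      unfolding Suc using insert.prems insert.hyps by (intro card_nsub_insert) auto
    also have "real \<dots> \<le> real ((?N - 1) choose m') * (real m' / real (?N - 1)) ^ card J"
      using insert.IH[of "R - {x}" m'] insert.prems insert.hyps N by auto
    also have "\<dots> \<le> real ((?N - 1) choose m') * (real m / real ?N) ^ card J"
    proof (intro mult_left_mono power_mono)
      show "real m' / real (?N - 1) \<le> real m / real ?N"
      proof (cases "?N = 1")
        case False
        then have "?N \<ge> 2" using insert.prems Suc by linarith
        moreover have "m' \<le> ?N - 1" by fact
        ultimately show ?thesis using Suc insert.prems
          by (simp add: divide_simps of_nat_diff algebra_simps)
      qed simp
    qed auto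
    also have "real ((?N - 1) choose m') = real (?N choose m) * (real m / real ?N)"
      unfolding Suc using insert.prems Suc by (intro binomial_Suc_Suc_real) auto
    finally show ?thesis using insert.hyps by (simp add: mult_ac)
  qed
qed

section \<open>Exponential moments and the upper tail\<close>

lemma sum_card_swap:
  assumes "finite A" "finite B"
  shows "(\<Sum>x\<in>A. \<Sum>y | y \<in> B \<and> P x y. f y) = (\<Sum>y\<in>B. real (card {x \<in> A. P x y}) * f y)"
proof -
  have "(\<Sum>x\<in>A. \<Sum>y | y \<in> B \<and> P x y. f y) = (\<Sum>x\<in>A. \<Sum>y\<in>B. if P x y then f y else 0)"
    by (intro sum.cong refl sum.inter_filter assms(2))
  also have "\<dots> = (\<Sum>y\<in>B. \<Sum>x\<in>A. if P x y then f y else 0)" by (rule sum.swap)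
  also have "\<dots> = (\<Sum>y\<in>B. real (card {x \<in> A. P x y}) * f y)"
    by (intro sum.cong refl) (simp add: sum.inter_filter[OF assms(1), symmetric])
  finally show ?thesis .
qed

lemma power_card_eq_sum_Pow:
  assumes "finite B"
  shows "(1 + y) ^ card B = (\<Sum>J\<in>Pow B. y ^ card J :: real)"
proof -
  have "(1 + y) ^ card B = (\<Prod>x\<in>B. y + 1)" by (simp add: add.commute)
  also have "\<dots> = (\<Sum>J\<in>Pow B. (\<Prod>x\<in>J. y) * (\<Prod>x\<in>B - J. 1))" using assms by (rule prod_add)
  finally show ?thesis by simp
qed

text \<open>The moment generating function of a sample without replacement is at most the binomial one:
  expanding \<open>(1 + y) ^ k\<close> over subsets leaves only inclusion probabilities with nonnegative weights.\<close>

lemma nsub_mgf: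
  assumes "finite R" "A \<subseteq> R" "m \<le> card R" "y \<ge> 0"
  shows "(\<Sum>T\<in>nsub R m. (1 + y) ^ card (A \<inter> T))
           \<le> real (card R choose m) * (1 + y * (real m / real (card R))) ^ card A"
proof -
  have finA: "finite A" using assms finite_subset by blast
  have "(\<Sum>T\<in>nsub R m. (1 + y) ^ card (A \<inter> T)) =
      (\<Sum>T\<in>nsub R m. \<Sum>J | J \<in> Pow A \<and> J \<subseteq> T. y ^ card J)"
  proof (intro sum.cong refl)
    fix T
    have "{J. J \<in> Pow A \<and> J \<subseteq> T} = Pow (A \<inter> T)" by auto
    then show "(1 + y) ^ card (A \<inter> T) = (\<Sum>J | J \<in> Pow A \<and> J \<subseteq> T. y ^ card J)"
      using finA by (simp add: power_card_eq_sum_Pow)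
  qed
  also have "\<dots> = (\<Sum>J\<in>Pow A. real (card {T \<in> nsub R m. J \<subseteq> T}) * y ^ card J)"
    using finA assms(1) by (intro sum_card_swap finite_nsub) auto
  also have "\<dots> \<le> (\<Sum>J\<in>Pow A.
      (real (card R choose m) * (real m / real (card R)) ^ card J) * y ^ card J)"
    using assms finA by (intro sum_mono mult_right_mono card_nsub_supset) (auto intro: finite_subset)
  also have "\<dots> = real (card R choose m) * (\<Sum>J\<in>Pow A. (y * (real m / real (card R))) ^ card J)"
    by (simp add: sum_distrib_left power_mult_distrib mult_ac power_divide)
  also have "\<dots> = real (card R choose m) * (1 + y * (real m / real (card R))) ^ card A"
    using finA by (simp add: power_card_eq_sum_Pow)
  finally show ?thesis .
qed

text \<open>Chernoff's argument with the convenient base 1 + y for y = \<eta>/2: the threshold is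
  bounded from below by ln (1 + y) \<ge> y - y^2, the moment from above by 1 + y/2 \<le> exp (y/2).
  The difference of the exponents is exactly the stated one.\<close>

lemma nsub_half_tail:
  assumes "finite R" "A \<subseteq> R" "card R = 2 * m" "0 \<le> \<eta>" "\<eta> \<le> 1"
  shows "real (card {T \<in> nsub R m. (1 + \<eta>) * (real (card A) / 2) \<le> real (card (A \<inter> T))})
           \<le> real ((2 * m) choose m) * exp (- (real (card A) * \<eta>\<^sup>2 * (1 - \<eta>) / 8))"
proof -
  let ?r = "real (card A)"
  let ?B = "{T \<in> nsub R m. (1 + \<eta>) * (?r / 2) \<le> real (card (A \<inter> T))}"
  define y where "y = \<eta> / 2"
  have y: "0 \<le> y" "y \<le> 1 / 2" using assms by (auto simp: y_def)
  define \<theta> where "\<theta> = exp ((1 + \<eta>) * (?r / 2) * (y - y\<^sup>2))"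
  have fin: "finite (nsub R m)" using assms by (simp add: finite_nsub)
  have low: "\<theta> \<le> (1 + y) ^ card (A \<inter> T)" if "T \<in> ?B" for T
  proof -
    have "(1 + \<eta>) * (?r / 2) * (y - y\<^sup>2) \<le> real (card (A \<inter> T)) * ln (1 + y)"
      using that y ln_one_plus_pos_lower_bound[of y] assms(4)
      by (intro mult_mono) (auto simp: power2_eq_square mult_left_le)
    then have "\<theta> \<le> exp (real (card (A \<inter> T)) * ln (1 + y))" by (simp add: \<theta>_def)
    also have "\<dots> = (1 + y) ^ card (A \<inter> T)" using y by (simp add: exp_of_nat_mult)
    finally show ?thesis .
  qed
  have "real (card ?B) * \<theta> = (\<Sum>T\<in>?B. \<theta>)" by simp
  also have "\<dots> \<le> (\<Sum>T\<in>?B. (1 + y) ^ card (A \<inter> T))" by (intro sum_mono low)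
  also have "\<dots> \<le> (\<Sum>T\<in>nsub R m. (1 + y) ^ card (A \<inter> T))"
    using fin y by (intro sum_mono2) auto
  also have "\<dots> \<le> real (card R choose m) * (1 + y * (real m / real (card R))) ^ card A"
    using assms y by (intro nsub_mgf) auto
  also have "\<dots> \<le> real (card R choose m) * (exp (y / 2)) ^ card A"
  proof (intro mult_left_mono power_mono)
    have "y * (real m / real (card R)) \<le> y * (1 / 2)"
      using assms y by (intro mult_left_mono) auto
    also have "\<dots> = y / 2" by simp
    finally show "1 + y * (real m / real (card R)) \<le> exp (y / 2)"
      using exp_ge_add_one_self[of "y / 2"] by linarith
  qed (use y in auto)
  also have "(exp (y / 2)) ^ card A = exp (?r * (y / 2))" by (rule exp_of_nat_mult[symmetric])
  finally have "real (card ?B) \<le> real (card R choose m) * (exp (?r * (y / 2)) / \<theta>)"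
    by (simp add: field_simps \<theta>_def)
  also have "exp (?r * (y / 2)) / \<theta> = exp (?r * (y / 2) - (1 + \<eta>) * (?r / 2) * (y - y\<^sup>2))"
    by (simp add: exp_diff \<theta>_def)
  also have "?r * (y / 2) - (1 + \<eta>) * (?r / 2) * (y - y\<^sup>2) = - (?r * \<eta>\<^sup>2 * (1 - \<eta>) / 8)"
    by (simp add: y_def field_simps power2_eq_square)
  finally show ?thesis using assms by simp
qed

section \<open>Mean and variance of a sample count\<close>

lemma nsub_first_moment:
  assumes "finite R" "A \<subseteq> R" "m \<le> card R"
  shows "(\<Sum>T\<in>nsub R m. real (card (A \<inter> T)))
           = real (card R choose m) * (real (card A) * (real m / real (card R)))"
proof -
  have finA: "finite A" using assms finite_subset by blast
  have "(\<Sum>T\<in>nsub R m. real (card (A \<inter> T))) = (\<Sum>T\<in>nsub R m. \<Sum>x | x \<in> A \<and> x \<in> T. 1)"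
    by (intro sum.cong refl) (simp add: Collect_conj_eq)
  also have "\<dots> = (\<Sum>x\<in>A. real (card {T \<in> nsub R m. x \<in> T}) * 1)"
    using finA assms(1) by (intro sum_card_swap finite_nsub)
  also have "\<dots> = (\<Sum>x\<in>A. real (card R choose m) * (real m / real (card R)))"
    using assms by (intro sum.cong refl) (auto simp: card_nsub_member)
  finally show ?thesis by simp
qed

text \<open>Over ordered pairs, the diagonal accounts for \<mu> and negative correlation bounds the
  rest by \<mu>^2. So the variance is at most \<mu>.\<close>

lemma nsub_second_moment:
  assumes "finite R" "A \<subseteq> R" "m \<le> card R" "\<mu> = real (card A) * (real m / real (card R))"
  shows "(\<Sum>T\<in>nsub R m. (real (card (A \<inter> T)))\<^sup>2) \<le> real (card R choose m) * (\<mu> + \<mu>\<^sup>2)"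
proof -
  let ?C = "real (card R choose m)"
  let ?p = "real m / real (card R)"
  have finA: "finite A" using assms finite_subset by blast
  have "(\<Sum>T\<in>nsub R m. (real (card (A \<inter> T)))\<^sup>2) =
      (\<Sum>T\<in>nsub R m. \<Sum>z | z \<in> A \<times> A \<and> {fst z, snd z} \<subseteq> T. 1)"
  proof (intro sum.cong refl)
    fix T
    have "{z. z \<in> A \<times> A \<and> {fst z, snd z} \<subseteq> T} = (A \<inter> T) \<times> (A \<inter> T)" by auto
    then show "(real (card (A \<inter> T)))\<^sup>2 = (\<Sum>z | z \<in> A \<times> A \<and> {fst z, snd z} \<subseteq> T. 1)"
      by (simp add: card_cartesian_product power2_eq_square)
  qed
  also have "\<dots> = (\<Sum>z\<in>A \<times> A. real (card {T \<in> nsub R m. {fst z, snd z} \<subseteq> T}) * 1)"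
    using finA assms(1) by (intro sum_card_swap finite_nsub) auto
  also have "\<dots> = (\<Sum>x\<in>A. \<Sum>y\<in>A. real (card {T \<in> nsub R m. {x, y} \<subseteq> T}))"
    by (simp add: sum.cartesian_product case_prod_unfold)
  also have "\<dots> \<le> (\<Sum>x\<in>A. \<Sum>y\<in>A. (if y = x then ?C * ?p else 0) + ?C * ?p\<^sup>2)"
  proof (intro sum_mono)
    fix x y assume xy: "x \<in> A" "y \<in> A"
    have "real (card {T \<in> nsub R m. {x, y} \<subseteq> T}) \<le> ?C * ?p ^ card {x, y}"
      using assms xy by (intro card_nsub_supset) auto
    then show "real (card {T \<in> nsub R m. {x, y} \<subseteq> T}) \<le> (if y = x then ?C * ?p else 0) + ?C * ?p\<^sup>2"
      by (cases "x = y") (auto simp: power2_eq_square intro: order_trans)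
  qed
  also have "\<dots> = ?C * (\<mu> + \<mu>\<^sup>2)"
    using finA by (simp add: sum.distrib assms(4) algebra_simps power2_eq_square)
  finally show ?thesis .
qed

lemma nsub_chebyshev:
  assumes "finite R" "A \<subseteq> R" "m \<le> card R" "\<mu> = real (card A) * (real m / real (card R))" "\<delta> \<ge> 0"
  shows "real (card {T \<in> nsub R m. \<delta> \<le> \<bar>real (card (A \<inter> T)) - \<mu>\<bar>}) * \<delta>\<^sup>2
           \<le> real (card R choose m) * \<mu>"
proof -
  let ?C = "real (card R choose m)"
  let ?B = "{T \<in> nsub R m. \<delta> \<le> \<bar>real (card (A \<inter> T)) - \<mu>\<bar>}"
  let ?X = "\<lambda>T. real (card (A \<inter> T))"
  have fin: "finite (nsub R m)" using assms by (simp add: finite_nsub)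
  have "real (card ?B) * \<delta>\<^sup>2 = (\<Sum>T\<in>?B. \<delta>\<^sup>2)" by simp
  also have "\<dots> \<le> (\<Sum>T\<in>?B. (?X T - \<mu>)\<^sup>2)"
    using assms(5) by (intro sum_mono) (auto simp: abs_le_square_iff[symmetric])
  also have "\<dots> \<le> (\<Sum>T\<in>nsub R m. (?X T - \<mu>)\<^sup>2)"
    using fin by (intro sum_mono2) auto
  also have "\<dots> = (\<Sum>T\<in>nsub R m. (?X T)\<^sup>2 - 2 * \<mu> * ?X T + \<mu>\<^sup>2)"
    by (intro sum.cong refl) (simp add: power2_eq_square algebra_simps)
  also have "\<dots> = (\<Sum>T\<in>nsub R m. (?X T)\<^sup>2) - 2 * \<mu> * (\<Sum>T\<in>nsub R m. ?X T) + ?C * \<mu>\<^sup>2"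
    using assms(1) by (simp add: sum.distrib sum_subtractf sum_distrib_left card_nsub)
  also have "(\<Sum>T\<in>nsub R m. ?X T) = ?C * \<mu>" using assms by (simp add: nsub_first_moment)
  also have "(\<Sum>T\<in>nsub R m. (?X T)\<^sup>2) \<le> ?C * (\<mu> + \<mu>\<^sup>2)"
    using assms by (intro nsub_second_moment) auto
  finally show ?thesis by (simp add: algebra_simps power2_eq_square)
qed

section \<open>A sample and its ghost as halves of one set\<close>

text \<open>Drawing \<open>T\<close> and then \<open>T'\<close> from the rest amounts to drawing the
  union \<open>R\<close> and then one half of it: (T, T') corresponds to (R, T).\<close>

lemma nsub_pairs:
  assumes "finite V"
  shows "(\<Sum>T\<in>nsub V s. card {T' \<in> nsub (V - T) s. Q T T'})
           = (\<Sum>R\<in>nsub V (2 * s). card {T \<in> nsub R s. Q T (R - T)})"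
proof -
  let ?A = "SIGMA T:nsub V s. {T' \<in> nsub (V - T) s. Q T T'}"
  let ?B = "SIGMA R:nsub V (2 * s). {T \<in> nsub R s. Q T (R - T)}"
  have fin: "finite T" if "T \<subseteq> V" for T using that assms finite_subset by blast
  have "bij_betw (\<lambda>(T, T'). (T \<union> T', T)) ?A ?B"
  proof (rule bij_betwI[where g = "\<lambda>(R, T). (T, R - T)"])
    show "(\<lambda>(T, T'). (T \<union> T', T)) \<in> ?A \<rightarrow> ?B"
    proof (rule funcsetI)
      fix z assume "z \<in> ?A"
      then obtain T T' where z: "z = (T, T')" "T \<subseteq> V" "card T = s" "T' \<subseteq> V - T" "card T' = s" "Q T T'"
        by (auto simp: nsub_def)
      have "card (T \<union> T') = 2 * s" using z fin[of T] fin[of T'] by (subst card_Un_disjoint) auto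
      moreover have "T \<union> T' - T = T'" using z by auto
      ultimately show "(case z of (T, T') \<Rightarrow> (T \<union> T', T)) \<in> ?B" using z by (auto simp: nsub_def)
    qed
    show "(\<lambda>(R, T). (T, R - T)) \<in> ?B \<rightarrow> ?A"
    proof (rule funcsetI)
      fix z assume "z \<in> ?B"
      then obtain R T where z: "z = (R, T)" "R \<subseteq> V" "card R = 2 * s" "T \<subseteq> R" "card T = s" "Q T (R - T)"
        by (auto simp: nsub_def)
      have "card (R - T) = s" using z fin[of T] by (subst card_Diff_subset) auto
      then show "(case z of (R, T) \<Rightarrow> (T, R - T)) \<in> ?A" using z by (auto simp: nsub_def)
    qed
  qed (auto simp: nsub_def)
  then have "card ?A = card ?B" by (rule bij_betw_same_card)
  moreover have "card ?A = (\<Sum>T\<in>nsub V s. card {T' \<in> nsub (V - T) s. Q T T'})"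
    using assms by (intro card_SigmaI) (auto simp: finite_nsub)
  moreover have "card ?B = (\<Sum>R\<in>nsub V (2 * s). card {T \<in> nsub R s. Q T (R - T)})"
    using assms by (intro card_SigmaI) (auto simp: nsub_def dest: finite_subset)
  ultimately show ?thesis by simp
qed

text \<open>\<open>Bad\<close> may refer to all of \<open>V\<close>, while \<open>Q\<close> sees
  only the two samples. At least half of the ghosts expose a bad sample, which costs the factor 2;
  then \<open>R\<close> is fixed and only its division into halves is random.\<close>

lemma nsub_ghost_sample:
  assumes "finite V" "2 * s \<le> card V" "\<beta> \<ge> 0"
    and ghost: "\<And>T. T \<in> nsub V s \<Longrightarrow> Bad T \<Longrightarrow>
      real (card (nsub (V - T) s)) \<le> 2 * real (card {T' \<in> nsub (V - T) s. Q T T'})"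
    and half: "\<And>R. R \<in> nsub V (2 * s) \<Longrightarrow>
      real (card {T \<in> nsub R s. Q T (R - T)}) \<le> \<beta> * real ((2 * s) choose s)"
  shows "real (card {T \<in> nsub V s. Bad T}) \<le> 2 * \<beta> * real (card V choose s)"
proof -
  let ?n = "card V"
  have fin: "finite (nsub V s)" using assms(1) by (simp add: finite_nsub)
  have c1: "card (nsub (V - T) s) = (?n - s) choose s" if "T \<in> nsub V s" for T
    using that assms(1) by (auto simp: nsub_def n_subsets card_Diff_subset finite_subset)
  have c2: "card (nsub R s) = (2 * s) choose s" if "R \<in> nsub V (2 * s)" for R
    using that assms(1) by (auto simp: nsub_def n_subsets finite_subset)
  \<comment> \<open>Counting all disjoint pairs in both ways gives the common denominator.\<close>
  have total: "(?n choose s) * ((?n - s) choose s) = (?n choose (2 * s)) * ((2 * s) choose s)"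
  proof -
    have "(\<Sum>T\<in>nsub V s. card (nsub (V - T) s)) = (\<Sum>R\<in>nsub V (2 * s). card (nsub R s))"
      using nsub_pairs[OF assms(1), of s "\<lambda>_ _. True"] by simp
    also have "(\<Sum>T\<in>nsub V s. card (nsub (V - T) s)) = (?n choose s) * ((?n - s) choose s)"
      using assms(1) by (simp only: c1 sum_constant card_nsub cong: sum.cong) simp
    also have "(\<Sum>R\<in>nsub V (2 * s). card (nsub R s)) = (?n choose (2 * s)) * ((2 * s) choose s)"
      using assms(1) by (simp only: c2 sum_constant card_nsub cong: sum.cong) simp
    finally show ?thesis .
  qed
  have "real (card {T \<in> nsub V s. Bad T}) * real ((?n - s) choose s)
      = (\<Sum>T | T \<in> nsub V s \<and> Bad T. real (card (nsub (V - T) s)))"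
    by (simp add: c1)
  also have "\<dots> \<le> (\<Sum>T | T \<in> nsub V s \<and> Bad T. 2 * real (card {T' \<in> nsub (V - T) s. Q T T'}))"
    using ghost by (intro sum_mono) auto
  also have "\<dots> \<le> (\<Sum>T\<in>nsub V s. 2 * real (card {T' \<in> nsub (V - T) s. Q T T'}))"
    using fin by (intro sum_mono2) auto
  also have "\<dots> = 2 * real (\<Sum>T\<in>nsub V s. card {T' \<in> nsub (V - T) s. Q T T'})"
    by (simp add: sum_distrib_left)
  also have "\<dots> = 2 * (\<Sum>R\<in>nsub V (2 * s). real (card {T \<in> nsub R s. Q T (R - T)}))"
    by (simp add: nsub_pairs[OF assms(1)])
  also have "\<dots> \<le> 2 * (\<Sum>R\<in>nsub V (2 * s). \<beta> * real ((2 * s) choose s))"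
    using half by (intro mult_left_mono sum_mono) auto
  also have "\<dots> = 2 * \<beta> * real ((?n choose (2 * s)) * ((2 * s) choose s))"
    using assms(1) by (simp add: card_nsub)
  also have "\<dots> = 2 * \<beta> * real (?n choose s) * real ((?n - s) choose s)"
    unfolding total[symmetric] by simp
  finally have "real (card {T \<in> nsub V s. Bad T}) * real ((?n - s) choose s)
      \<le> 2 * \<beta> * real (?n choose s) * real ((?n - s) choose s)" .
  moreover have "real ((?n - s) choose s) > 0" using assms(2) by (simp add: zero_less_binomial_iff)
  ultimately show ?thesis by (simp only: mult_le_cancel_right_pos)
qed

section \<open>Random subsets are sample sets\<close>

text \<open>The variance is at most \<mu>, so \<open>2 * \<mu> \<le> \<delta>\<^sup>2\<close> bounds
  Chebyshev's failure probability by 1/2. A constant is all that a ghost has to provide.\<close>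

lemma nsub_concentration:
  assumes "finite U" "B \<subseteq> U" "s \<le> card U" "\<mu> = real (card B) * (real s / real (card U))"
    "\<delta> > 0" "2 * \<mu> \<le> \<delta>\<^sup>2"
  shows "real (card (nsub U s))
           \<le> 2 * real (card {T \<in> nsub U s. \<bar>real (card (B \<inter> T)) - \<mu>\<bar> < \<delta>})"
proof -
  let ?F = "{T \<in> nsub U s. \<delta> \<le> \<bar>real (card (B \<inter> T)) - \<mu>\<bar>}"
  let ?G = "{T \<in> nsub U s. \<bar>real (card (B \<inter> T)) - \<mu>\<bar> < \<delta>}"
  have fin: "finite (nsub U s)" using assms(1) by (rule finite_nsub)
  have "real (card ?F) * \<delta>\<^sup>2 \<le> real (card (nsub U s)) * \<mu>"
    using nsub_chebyshev[OF assms(1-4), of \<delta>] assms(1,5) by (simp add: card_nsub)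
  also have "\<dots> \<le> real (card (nsub U s)) * (\<delta>\<^sup>2 / 2)"
    using assms(6) by (intro mult_left_mono) auto
  finally have "real (card ?F) * \<delta>\<^sup>2 \<le> (real (card (nsub U s)) / 2) * \<delta>\<^sup>2" by simp
  then have "real (card ?F) \<le> real (card (nsub U s)) / 2"
    using assms(5) by (simp only: mult_le_cancel_right_pos zero_less_power)
  moreover have "card (nsub U s) = card ?F + card ?G"
    using fin by (subst card_Un_disjoint[symmetric]) (auto intro!: arg_cong[of _ _ card])
  ultimately show ?thesis by simp
qed

text \<open>The first count is the larger one, and its lower bound keeps the tail estimate
  effective. The 1/4 arises from a side with expected count at least \<mu>/2 whose ghost count is at
  least half of that expectation.\<close>

definition unbalanced :: "real \<Rightarrow> real \<Rightarrow> nat \<Rightarrow> nat \<Rightarrow> bool" where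
  "unbalanced \<epsilon> \<mu> a b \<longleftrightarrow> \<mu> / 4 \<le> real a \<and> real b \<le> (1 - \<epsilon> / 4) * real a"

text \<open>Write r for the size of \<open>A\<close>. Since (1 + \<epsilon>/8)(1 - \<epsilon>/8)
  \<le> 1, the larger part has at least (1 + \<epsilon>/8) r/2 elements. The tail exponent for
  \<eta> = \<epsilon>/8 is at least 7 \<epsilon>^2 r / 4096 \<ge> \<epsilon>^2 r / 600, and r \<ge>
  \<mu>/4 turns 600 into 2400.\<close>

lemma card_nsub_half_unbalanced:
  assumes "finite R" "A \<subseteq> R" "card R = 2 * s" "0 < \<epsilon>" "\<epsilon> < 1"
  shows "real (card {T \<in> nsub R s. unbalanced \<epsilon> \<mu> (card (A \<inter> T)) (card (A \<inter> (R - T)))})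
           \<le> real ((2 * s) choose s) * exp (- (\<epsilon>\<^sup>2 * \<mu> / 2400))"
proof -
  let ?r = "real (card A)"
  let ?U = "{T \<in> nsub R s. unbalanced \<epsilon> \<mu> (card (A \<inter> T)) (card (A \<inter> (R - T)))}"
  let ?tail = "{T \<in> nsub R s. (1 + \<epsilon> / 8) * (?r / 2) \<le> real (card (A \<inter> T))}"
  have finA: "finite A" using assms finite_subset by blast
  have r: "?r = real (card (A \<inter> T)) + real (card (A \<inter> (R - T)))" for T
  proof -
    have "A = (A \<inter> T) \<union> (A \<inter> (R - T))" using assms(2) by auto
    then have "card A = card (A \<inter> T) + card (A \<inter> (R - T))"
      using finA by (subst card_Un_disjoint[symmetric]) auto
    then show ?thesis by simp
  qed
  show ?thesis
  proof (cases "?r < \<mu> / 4")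
    case True
    then have "\<not> unbalanced \<epsilon> \<mu> (card (A \<inter> T)) (card (A \<inter> (R - T)))" for T
      using r[of T] by (simp add: unbalanced_def)
    then show ?thesis by simp
  next
    case False
    have "?U \<subseteq> ?tail"
    proof
      fix T assume T: "T \<in> ?U"
      define a where "a = real (card (A \<inter> T))"
      have "?r \<le> (2 - \<epsilon> / 4) * a"
        using T r[of T] by (simp add: unbalanced_def a_def algebra_simps)
      then have "(1 + \<epsilon> / 8) * (?r / 2) \<le> (1 + \<epsilon> / 8) * ((2 - \<epsilon> / 4) * a / 2)"
        using assms(4) by (intro mult_left_mono divide_right_mono) auto
      also have "\<dots> = a - \<epsilon>\<^sup>2 / 64 * a" by (simp add: field_simps power2_eq_square)
      also have "\<dots> \<le> a" by (simp add: a_def)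
      finally show "T \<in> ?tail" using T by (simp add: a_def)
    qed
    then have "real (card ?U) \<le> real (card ?tail)"
      using assms(1) by (intro of_nat_mono card_mono) (auto simp: finite_nsub)
    also have "\<dots> \<le> real ((2 * s) choose s) * exp (- (?r * (\<epsilon> / 8)\<^sup>2 * (1 - \<epsilon> / 8) / 8))"
      using assms by (intro nsub_half_tail) auto
    also have "\<dots> \<le> real ((2 * s) choose s) * exp (- (\<epsilon>\<^sup>2 * \<mu> / 2400))"
    proof -
      have "\<epsilon>\<^sup>2 * \<mu> / 2400 \<le> \<epsilon>\<^sup>2 * (4 * ?r) / 2400"
        using False by (intro divide_right_mono mult_left_mono) auto
      also have "\<dots> = 1 / 600 * (?r * \<epsilon>\<^sup>2)" by simp
      also have "\<dots> \<le> 7 / 4096 * (?r * \<epsilon>\<^sup>2)" by (intro mult_right_mono) auto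
      also have "\<dots> = ?r * (\<epsilon> / 8)\<^sup>2 * (7 / 8) / 8" by (simp add: power_divide)
      also have "\<dots> \<le> ?r * (\<epsilon> / 8)\<^sup>2 * (1 - \<epsilon> / 8) / 8"
        using assms by (intro divide_right_mono mult_left_mono) auto
      finally show ?thesis by (intro mult_left_mono) auto
    qed
    finally show ?thesis .
  qed
qed

text \<open>Complementation permutes the halves of \<open>R\<close>. Hence samples with too few
  elements are as frequent as samples with too many, and the upper tail settles both.\<close>

lemma card_nsub_half_complement:
  assumes "finite R" "card R = 2 * s"
  shows "card {T \<in> nsub R s. P (R - T)} = card {T \<in> nsub R s. P T}"
proof (rule bij_betw_same_card[of "\<lambda>T. R - T"])
  have c: "card (R - T) = s" if "T \<subseteq> R" "card T = s" for T
    using that assms finite_subset[OF that(1) assms(1)] by (simp add: card_Diff_subset)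
  show "bij_betw (\<lambda>T. R - T) {T \<in> nsub R s. P (R - T)} {T \<in> nsub R s. P T}"
    by (rule bij_betwI[where g = "\<lambda>T. R - T"]) (auto simp: nsub_def c double_diff)
qed

section \<open>Sides without boundary and parameters without sparse sides\<close>

lemma conn_nbhd_empty:
  assumes "conn E V" "W \<subseteq> V" "nbhd V E W = {}"
  shows "W = {} \<or> W = V"
proof (rule ccontr)
  assume "\<not> ?thesis"
  then obtain u v where uv: "u \<in> W" "v \<in> V" "v \<notin> W" using assms(2) by blast
  have "(u, v) \<in> (induced_adj E V)\<^sup>*" using assms uv by (auto simp: conn_def)
  then have "v \<in> W"
  proof (induction rule: rtrancl_induct)
    case base
    then show ?case using uv by simp
  next
    case (step y z)
    then show ?case using assms(3) by (auto simp: induced_adj_def nbhd_def)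
  qed
  then show False using uv by simp
qed

text \<open>In a connected graph an empty boundary leaves only \<open>{}\<close> and
  \<open>V\<close>, for which the scaled count is exact. This supplies the \<open>k \<ge> 1\<close>
  of the trace bound.\<close>

lemma vertex_sample_setI:
  assumes "finite V" "conn E V" "T \<subseteq> V" "T \<noteq> {}"
    and "\<And>W. W \<in> cut_sides V E (card (nbhd V E W)) \<Longrightarrow> card (nbhd V E W) \<ge> 1 \<Longrightarrow>
      vertex_sparsity V E W \<le> \<phi>' \<or>
        terminal_sparsity V E T W \<le> ereal (real (card V) / real (card T) * (\<phi>' / 10)) \<Longrightarrow>
      \<bar>real (card V) / real (card T) * real (card (W \<inter> T)) - real (card W)\<bar> \<le> \<epsilon> * real (card W)"
    and "\<epsilon> \<ge> 0"
  shows "vertex_sample_set V E \<epsilon> \<phi>' T"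
  unfolding vertex_sample_set_def
proof (intro conjI allI impI assms(3,4))
  fix W assume W: "W \<subseteq> V" "cut_side V E W"
    and sp: "vertex_sparsity V E W \<le> \<phi>' \<or>
        terminal_sparsity V E T W \<le> ereal (real (card V) / real (card T) * (\<phi>' / 10))"
  have finT: "finite T" using assms finite_subset by blast
  have finN: "finite (nbhd V E W)" using assms(1) by (auto simp: nbhd_def)
  show "\<bar>real (card V) / real (card T) * real (card (W \<inter> T)) - real (card W)\<bar> \<le> \<epsilon> * real (card W)"
  proof (cases "nbhd V E W = {}")
    case True
    from conn_nbhd_empty[OF assms(2) W(1) True] show ?thesis
    proof
      assume "W = V"
      moreover have "V \<inter> T = T" using assms(3) by auto
      ultimately show ?thesis using assms(4,6) finT by simp
    qed simp
  next
    case False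
    then have "card (nbhd V E W) \<ge> 1" using finN by (simp add: Suc_le_eq card_gt_0_iff)
    then show ?thesis using W sp by (intro assms(5)) (auto simp: cut_sides_def)
  qed
qed

lemma vertex_sample_set_whole:
  assumes "finite V" "V \<noteq> {}" "\<epsilon> \<ge> 0"
  shows "vertex_sample_set V E \<epsilon> \<phi>' V"
  using assms by (auto simp: vertex_sample_set_def Int_absorb2)

text \<open>A nonempty boundary forces the two sparsities to be at least 1/n and 1/|T|, so no such
  side is sparse in either sense. The case covers every \<phi>' \<le> 0.\<close>

lemma vertex_sample_set_trivial:
  assumes "finite V" "conn E V" "T \<subseteq> V" "T \<noteq> {}" "\<epsilon> \<ge> 0" "real (card V) * \<phi>' < 1"
  shows "vertex_sample_set V E \<epsilon> \<phi>' T"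
proof (rule vertex_sample_setI[OF assms(1-4) _ assms(5)])
  fix W assume W: "W \<in> cut_sides V E (card (nbhd V E W))" "card (nbhd V E W) \<ge> 1"
    and sp: "vertex_sparsity V E W \<le> \<phi>' \<or>
        terminal_sparsity V E T W \<le> ereal (real (card V) / real (card T) * (\<phi>' / 10))"
  let ?k = "real (card (nbhd V E W))" and ?n = "real (card V)"
  have finT: "finite T" using assms finite_subset by blast
  have T: "card T > 0" using finT assms(4) by (simp add: card_gt_0_iff)
  have WN: "W \<union> nbhd V E W \<subseteq> V" using W by (auto simp: cut_sides_def nbhd_def)
  have k: "?k \<ge> 1" using W(2) by simp
  have fin: "finite (W \<union> nbhd V E W)" using WN assms(1) finite_subset by blast
  have wn: "card (nbhd V E W) \<le> card (W \<union> nbhd V E W)" "card (W \<union> nbhd V E W) \<le> card V"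
    using fin WN assms(1) by (auto intro!: card_mono)
  have False if "vertex_sparsity V E W \<le> \<phi>'"
  proof -
    let ?d = "real (card (W \<union> nbhd V E W))"
    have d: "0 < ?d" "?d \<le> ?n" using wn k by linarith+
    have "?k \<le> \<phi>' * ?d" using that d(1) by (simp add: vertex_sparsity_def divide_simps)
    moreover from this have "\<phi>' > 0" using k d(1) by (smt (verit) mult_nonpos_nonneg)
    ultimately have "?k \<le> \<phi>' * ?n" using d by (smt (verit) mult_left_mono)
    then show False using k assms(6) by (simp add: mult.commute)
  qed
  moreover have False if "terminal_sparsity V E T W \<le> ereal (?n / real (card T) * (\<phi>' / 10))"
  proof -
    let ?d = "real (card ((W \<union> nbhd V E W) \<inter> T))"
    have d: "0 < ?d" using that by (auto simp: terminal_sparsity_def split: if_splits)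
    have d': "?d \<le> real (card T)" using finT by (intro of_nat_mono card_mono) auto
    have "?k / ?d \<le> ?n / real (card T) * (\<phi>' / 10)"
      using that d by (auto simp: terminal_sparsity_def split: if_splits)
    also have "\<dots> \<le> 1 / real (card T) * (1 / 10)"
      using assms(6) T by (simp add: divide_simps)
    finally have "?k * (real (card T) * 10) \<le> ?d" using d T by (simp add: divide_simps mult_ac)
    moreover have "real (card T) * 10 \<le> ?k * (real (card T) * 10)" using k mult_right_mono[OF k, of "real (card T) * 10"] by simp
    ultimately show False using d' T by simp
  qed
  ultimately show "\<bar>?n / real (card T) * real (card (W \<inter> T)) - real (card W)\<bar> \<le> \<epsilon> * real (card W)"
    using sp by blast
qed

section \<open>The union bound over sides\<close>

text \<open>\<open>dense\<close> feeds Chebyshev's inequality for the ghost. The left side of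
  \<open>union_bound\<close> multiplies the number of traces on 2s vertices by the tail probability,
  both for k = 1; for general k its k-th power appears.\<close>

locale sampling =
  fixes V :: "'a set" and E :: "'a set set" and \<epsilon> \<phi>' :: real and s :: nat and M :: real
  defines "M \<equiv> real s / (real (card V) * \<phi>')"
  assumes finite_V: "finite V" and conn_V: "conn E V"
    and eps: "0 < \<epsilon>" "\<epsilon> < 1" and phi: "0 < \<phi>'" "\<phi>' < 1 / 2"
    and two_s: "2 * s \<le> card V"
    and dense: "32 \<le> \<epsilon>\<^sup>2 * M"
    and union_bound: "48 * (2 * real s) ^ 5 * exp (- (\<epsilon>\<^sup>2 * M / 2400)) \<le> 1 / 16"
begin

text \<open>\<open>M\<close> is chosen such that \<open>k * M\<close> is the expected number of sampled vertices in a set of size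
  \<open>k / \<phi>'\<close>.\<close>

definition bad :: "'a set \<Rightarrow> 'a set \<Rightarrow> bool" where
  "bad T W \<longleftrightarrow>
     (real (card (nbhd V E W)) / (2 * \<phi>') \<le> real (card W) \<and>
        \<bar>real (card V) / real s * real (card (W \<inter> T)) - real (card W)\<bar> > \<epsilon> * real (card W)) \<or>
     (real (card W) < real (card (nbhd V E W)) / \<phi>' \<and>
        9 * (real (card (nbhd V E W)) * M) \<le> real (card (W \<inter> T)))"

text \<open>In contrast to \<open>bad\<close>, this depends on a side only through its boundary size
  and its traces on \<open>T\<close> and \<open>T'\<close>. Both directions occur because a sample
  may contain too much or too little of \<open>W\<close>.\<close>

definition unbalanced_pair :: "'a set \<Rightarrow> 'a set \<Rightarrow> bool" where
  "unbalanced_pair T T' \<longleftrightarrow> (\<exists>k\<in>{1..card V}. \<exists>W\<in>cut_sides V E k.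
     unbalanced \<epsilon> (real k * M) (card (W \<inter> T)) (card (W \<inter> T')) \<or>
     unbalanced \<epsilon> (real k * M) (card (W \<inter> T')) (card (W \<inter> T)))"

lemma M_ge: "32 \<le> M"
proof -
  have "\<epsilon>\<^sup>2 \<le> 1" using eps by (simp add: power_le_one)
  moreover have "M \<ge> 0" using phi by (simp add: M_def)
  ultimately have "\<epsilon>\<^sup>2 * M \<le> 1 * M" by (intro mult_right_mono)
  then show ?thesis using dense by simp
qed

lemma s_pos: "s > 0"
  using M_ge by (cases s) (auto simp: M_def)

lemma card_unbalanced_pair:
  assumes R: "R \<in> nsub V (2 * s)"
  shows "real (card {T \<in> nsub R s. unbalanced_pair T (R - T)}) \<le> 1 / 4 * real ((2 * s) choose s)"
proof -
  let ?C = "real ((2 * s) choose s)"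
  let ?U = "\<lambda>k A. {T \<in> nsub R s. unbalanced \<epsilon> (real k * M) (card (A \<inter> T)) (card (A \<inter> (R - T)))}"
  let ?U' = "\<lambda>k A. {T \<in> nsub R s. unbalanced \<epsilon> (real k * M) (card (A \<inter> (R - T))) (card (A \<inter> T))}"
  let ?Tr = "\<lambda>k. (\<lambda>W. W \<inter> R) ` cut_sides V E k"
  define q where "q = 48 * (2 * real s) ^ 5 * exp (- (\<epsilon>\<^sup>2 * M / 2400))"
  have q: "0 \<le> q" "q \<le> 1 / 16" using union_bound by (auto simp: q_def)
  have R': "finite R" "R \<subseteq> V" "card R = 2 * s"
    using R finite_V by (auto simp: nsub_def intro: finite_subset)
  have finTr: "finite (?Tr k)" for k
    by (rule finite_subset[of _ "Pow R"]) (use R' in auto)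
  have "{T \<in> nsub R s. unbalanced_pair T (R - T)} \<subseteq> (\<Union>k\<in>{1..card V}. \<Union>A\<in>?Tr k. ?U k A \<union> ?U' k A)"
  proof
    fix T assume "T \<in> {T \<in> nsub R s. unbalanced_pair T (R - T)}"
    then obtain k W where T: "T \<in> nsub R s" "k \<in> {1..card V}" "W \<in> cut_sides V E k"
      "unbalanced \<epsilon> (real k * M) (card (W \<inter> T)) (card (W \<inter> (R - T))) \<or>
       unbalanced \<epsilon> (real k * M) (card (W \<inter> (R - T))) (card (W \<inter> T))"
      by (auto simp: unbalanced_pair_def)
    have "W \<inter> T = (W \<inter> R) \<inter> T" "W \<inter> (R - T) = (W \<inter> R) \<inter> (R - T)"
      using T(1) by (auto simp: nsub_def)
    with T have "T \<in> ?U k (W \<inter> R) \<union> ?U' k (W \<inter> R)" by auto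
    with T(2,3) show "T \<in> (\<Union>k\<in>{1..card V}. \<Union>A\<in>?Tr k. ?U k A \<union> ?U' k A)" by blast
  qed
  then have "card {T \<in> nsub R s. unbalanced_pair T (R - T)}
      \<le> card (\<Union>k\<in>{1..card V}. \<Union>A\<in>?Tr k. ?U k A \<union> ?U' k A)"
    using R'(1) by (intro card_mono finite_UN_I finTr) (simp_all add: finite_nsub)
  also have "\<dots> \<le> (\<Sum>k\<in>{1..card V}. card (\<Union>A\<in>?Tr k. ?U k A \<union> ?U' k A))"
    by (rule card_UN_le) simp
  also have "\<dots> \<le> (\<Sum>k\<in>{1..card V}. \<Sum>A\<in>?Tr k. card (?U k A \<union> ?U' k A))"
    by (intro sum_mono card_UN_le finTr)
  finally have "real (card {T \<in> nsub R s. unbalanced_pair T (R - T)})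
      \<le> (\<Sum>k\<in>{1..card V}. \<Sum>A\<in>?Tr k. real (card (?U k A \<union> ?U' k A)))"
    by (simp only: of_nat_sum[symmetric] of_nat_le_iff)
  also have "\<dots> \<le> (\<Sum>k\<in>{1..card V}. 2 * ?C * q ^ k)"
  proof (intro sum_mono)
    fix k assume k: "k \<in> {1..card V}"
    have "(\<Sum>A\<in>?Tr k. real (card (?U k A \<union> ?U' k A)))
        \<le> (\<Sum>A\<in>?Tr k. 2 * (?C * exp (- (\<epsilon>\<^sup>2 * (real k * M) / 2400))))"
    proof (intro sum_mono)
      fix A assume "A \<in> ?Tr k"
      then have A: "A \<subseteq> R" by auto
      have "card (?U' k A) = card (?U k A)"
      proof -
        have "card (?U' k A) = card {T \<in> nsub R s. (\<lambda>T. unbalanced \<epsilon> (real k * M)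
            (card (A \<inter> T)) (card (A \<inter> (R - T)))) (R - T)}"
          by (intro arg_cong[of _ _ card]) (auto simp: nsub_def double_diff)
        also have "\<dots> = card (?U k A)" by (rule card_nsub_half_complement[OF R'(1,3)])
        finally show ?thesis .
      qed
      then have "real (card (?U k A \<union> ?U' k A)) \<le> 2 * real (card (?U k A))"
        using card_Un_le[of "?U k A" "?U' k A"] by linarith
      also have "\<dots> \<le> 2 * (?C * exp (- (\<epsilon>\<^sup>2 * (real k * M) / 2400)))"
        using card_nsub_half_unbalanced[OF R'(1) A R'(3) eps] by (intro mult_left_mono) auto
      finally show "real (card (?U k A \<union> ?U' k A)) \<le> 2 * (?C * exp (- (\<epsilon>\<^sup>2 * (real k * M) / 2400)))" .
    qed
    also have "\<dots> = real (card (?Tr k)) * (2 * (?C * exp (- (\<epsilon>\<^sup>2 * (real k * M) / 2400))))" by simp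
    also have "\<dots> \<le> (48 * (2 * real s) ^ 5) ^ k * (2 * (?C * exp (- (\<epsilon>\<^sup>2 * (real k * M) / 2400))))"
    proof (rule mult_right_mono)
      have "card (?Tr k) \<le> (48 * (2 * s) ^ 5) ^ k"
        using R' s_pos k by (intro card_traces_cut_sides[OF finite_V conn_V]) auto
      then have "real (card (?Tr k)) \<le> real ((48 * (2 * s) ^ 5) ^ k)" by (rule of_nat_mono)
      then show "real (card (?Tr k)) \<le> (48 * (2 * real s) ^ 5) ^ k" by simp
    qed simp
    also have "exp (- (\<epsilon>\<^sup>2 * (real k * M) / 2400)) = exp (- (\<epsilon>\<^sup>2 * M / 2400)) ^ k"
      by (simp add: exp_of_nat_mult[symmetric] mult_ac)
    also have "(48 * (2 * real s) ^ 5) ^ k * (2 * (?C * exp (- (\<epsilon>\<^sup>2 * M / 2400)) ^ k)) = 2 * ?C * q ^ k"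
      by (simp only: q_def power_mult_distrib mult_ac)
    finally show "(\<Sum>A\<in>?Tr k. real (card (?U k A \<union> ?U' k A))) \<le> 2 * ?C * q ^ k" .
  qed
  also have "\<dots> = 2 * ?C * (\<Sum>k\<in>{1..card V}. q ^ k)" by (simp add: sum_distrib_left)
  \<comment> \<open>The series is at most 2q \<le> 1/8; the two directions of imbalance double this
    to 1/4.\<close>
  also have "(\<Sum>k\<in>{1..card V}. q ^ k) \<le> 1 / 8"
  proof -
    have "(\<Sum>k\<in>{1..card V}. q ^ k) = q * (\<Sum>k<card V. q ^ k)"
      by (simp add: sum_distrib_left sum.atLeast1_atMost_eq)
    also have "(\<Sum>k<card V. q ^ k) \<le> (\<Sum>k<card V. (1 / 2) ^ k)"
      using q by (intro sum_mono power_mono) auto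
    also have "\<dots> \<le> 2" by (simp add: sum_gp_strict)
    finally have "(\<Sum>k\<in>{1..card V}. q ^ k) \<le> q * 2" using q by (simp add: mult_left_mono)
    then show ?thesis using q by simp
  qed
  finally show ?thesis by simp
qed

text \<open>The ghost is drawn from \<open>V - T\<close>, so its mean \<mu>' moves away from the
  count of the sample: what the sample took in excess is missing outside, and conversely. A ghost
  near its mean therefore exposes the deviation.\<close>

lemma bad_imp_unbalanced_pairs:
  assumes T: "T \<in> nsub V s" and W: "W \<in> cut_sides V E k" "k \<ge> 1" "bad T W"
  shows "real (card (nsub (V - T) s)) \<le> 2 * real (card {T' \<in> nsub (V - T) s. unbalanced_pair T T'})"
proof -
  let ?n = "real (card V)"
  define a where "a = real (card (W \<inter> T))"
  define w where "w = real (card W)"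
  define m where "m = w * (real s / ?n)"
  define \<mu> where "\<mu> = real k * M"
  define \<mu>' where "\<mu>' = real (card (W - T)) * (real s / real (card (V - T)))"
  have W': "W \<subseteq> V" "card (nbhd V E W) = k" using W by (auto simp: cut_sides_def)
  have T': "T \<subseteq> V" "card T = s" "finite T" "finite W"
    using T W' finite_V by (auto simp: nsub_def intro: finite_subset)
  have "nbhd V E W \<subseteq> V" by (auto simp: nbhd_def)
  then have k: "k \<in> {1..card V}" using W(2) W'(2) card_mono[OF finite_V] by auto
  have sn: "0 < real s" "2 * real s \<le> ?n" using s_pos two_s by auto
  have cVT: "real (card (V - T)) = ?n - real s"
    using T' two_s by (simp add: card_Diff_subset of_nat_diff)
  have cWT: "real (card (W - T)) = w - a"
  proof -
    have "card W = card (W - T) + card (W \<inter> T)"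
      using T' by (subst card_Un_disjoint[symmetric]) (auto intro: arg_cong[of _ _ card])
    then show ?thesis by (simp add: w_def a_def)
  qed
  have aw: "0 \<le> a" "a \<le> w" using T' by (auto simp: a_def w_def intro: card_mono)
  have \<mu>'_eq: "\<mu>' * (?n - real s) = (w - a) * real s"
    using sn by (simp add: \<mu>'_def cVT cWT)
  have m_n: "m * ?n = w * real s" using sn by (simp add: m_def)
  have nM: "?n * \<phi>' * M = real s" using M_ge sn phi by (simp add: M_def)
  have \<mu>_ge: "32 \<le> \<epsilon>\<^sup>2 * \<mu>" "2 \<le> \<mu>"
  proof -
    have "M \<le> \<mu>" using W(2) M_ge by (simp add: \<mu>_def mult_le_cancel_right1)
    then have "\<epsilon>\<^sup>2 * M \<le> \<epsilon>\<^sup>2 * \<mu>" by (intro mult_left_mono) auto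
    then show "32 \<le> \<epsilon>\<^sup>2 * \<mu>" "2 \<le> \<mu>" using dense M_ge \<open>M \<le> \<mu>\<close> by auto
  qed
  have \<mu>'_up: "\<mu>' \<le> m" if "m \<le> a"
  proof -
    have "\<mu>' * (?n - real s) \<le> (w - m) * real s" unfolding \<mu>'_eq using that sn by (intro mult_right_mono) auto
    also have "\<dots> = m * (?n - real s)" using m_n by (simp add: algebra_simps)
    finally show ?thesis using sn by simp
  qed
  \<comment> \<open>Each case then needs only a radius \<delta> large enough for Chebyshev's
    inequality and small enough that every count within \<delta> of \<mu>' is unbalanced against
    that of the sample.\<close>
  have *: ?thesis if "\<delta> > 0" "2 * \<mu>' \<le> \<delta>\<^sup>2"
    and imp: "\<And>b. \<bar>real b - \<mu>'\<bar> < \<delta> \<Longrightarrow>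
      unbalanced \<epsilon> \<mu> (card (W \<inter> T)) b \<or> unbalanced \<epsilon> \<mu> b (card (W \<inter> T))" for \<delta>
  proof -
    have "s \<le> card (V - T)" using cVT sn by linarith
    then have "real (card (nsub (V - T) s))
        \<le> 2 * real (card {T' \<in> nsub (V - T) s. \<bar>real (card ((W - T) \<inter> T')) - \<mu>'\<bar> < \<delta>})"
      using finite_V W' that by (intro nsub_concentration) (auto simp: \<mu>'_def)
    also have "\<dots> \<le> 2 * real (card {T' \<in> nsub (V - T) s. unbalanced_pair T T'})"
    proof (intro mult_left_mono of_nat_mono card_mono subsetI)
      fix T' assume T': "T' \<in> {T' \<in> nsub (V - T) s. \<bar>real (card ((W - T) \<inter> T')) - \<mu>'\<bar> < \<delta>}"
      then have "(W - T) \<inter> T' = W \<inter> T'" by (auto simp: nsub_def)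
      then have "unbalanced_pair T T'" using T' imp[of "card (W \<inter> T')"] k W(1)
        unfolding unbalanced_pair_def \<mu>_def by auto
      then show "T' \<in> {T' \<in> nsub (V - T) s. unbalanced_pair T T'}" using T' by simp
    qed (use finite_V in \<open>auto simp: finite_nsub\<close>)
    finally show ?thesis .
  qed
  from W(3) consider
      (dev) "real k / (2 * \<phi>') \<le> w" "\<bar>?n / real s * a - w\<bar> > \<epsilon> * w"
    | (over) "w < real k / \<phi>'" "9 * \<mu> \<le> a"
    unfolding bad_def W'(2) a_def w_def \<mu>_def by blast
  then show ?thesis
  proof cases
    case over
    \<comment> \<open>With m \<le> \<mu>, a ghost count within \<mu> of its mean is at most 2\<mu>,
      against at least 9\<mu> in the sample. The ratio 2/9 is well below 3/4 \<le> 1 -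
      \<epsilon>/4.\<close>
    have "m * ?n \<le> (real k / \<phi>') * real s" unfolding m_n using over sn by (intro mult_right_mono) auto
    also have "\<dots> = \<mu> * ?n" using nM phi by (simp add: \<mu>_def field_simps)
    finally have m\<mu>: "m \<le> \<mu>" using sn by simp
    then have "\<mu>' \<le> \<mu>" using \<mu>'_up over \<mu>_ge by linarith
    show ?thesis
    proof (rule *)
      show "\<mu> > 0" using \<mu>_ge by simp
      have "2 * \<mu>' \<le> \<mu> * \<mu>" using \<mu>_ge \<open>\<mu>' \<le> \<mu>\<close> mult_right_mono[of 2 \<mu> \<mu>] by linarith
      then show "2 * \<mu>' \<le> \<mu>\<^sup>2" by (simp add: power2_eq_square)
      fix b :: nat assume "\<bar>real b - \<mu>'\<bar> < \<mu>"
      then have "real b \<le> 2 * \<mu>" using \<open>\<mu>' \<le> \<mu>\<close> by linarith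
      then have "real b \<le> 3 / 4 * a" using over \<mu>_ge by linarith
      also have "\<dots> \<le> (1 - \<epsilon> / 4) * a" using eps aw by (intro mult_right_mono) auto
      finally show "unbalanced \<epsilon> \<mu> (card (W \<inter> T)) b \<or> unbalanced \<epsilon> \<mu> b (card (W \<inter> T))"
        using over \<mu>_ge by (auto simp: unbalanced_def a_def)
    qed
  next
    case dev
    have "(real k / (2 * \<phi>')) * real s \<le> m * ?n" unfolding m_n using dev sn by (intro mult_right_mono) auto
    moreover have "(real k / (2 * \<phi>')) * real s = \<mu> / 2 * ?n"
      using nM phi by (simp add: \<mu>_def field_simps)
    ultimately have "\<mu> / 2 * ?n \<le> m * ?n" by linarith
    then have m\<mu>: "\<mu> / 2 \<le> m" using sn by (simp only: mult_le_cancel_right_pos)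
    have "\<epsilon>\<^sup>2 * (\<mu> / 2) \<le> \<epsilon>\<^sup>2 * m" using m\<mu> by (intro mult_left_mono) auto
    then have em: "16 \<le> \<epsilon>\<^sup>2 * m" using \<mu>_ge by linarith
    have m0: "m > 0" using m\<mu> \<mu>_ge by linarith
    \<comment> \<open>The ghost may use up half of the relative deviation \<epsilon>. The 32 of
      \<open>dense\<close> has become 16 \<le> \<epsilon>^2 m, so \<delta>^2 \<ge> 4m, as needed for
      means \<mu>' up to 2m.\<close>
    define \<delta> where "\<delta> = \<epsilon> * m / 2"
    have \<delta>: "\<delta> > 0" "4 * m \<le> \<delta>\<^sup>2"
      using eps m0 mult_right_mono[OF em, of m]
      by (auto simp: \<delta>_def power2_eq_square field_simps)
    have ndev: "?n / real s * a - w = ?n / real s * (a - m)"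
      using sn by (simp add: m_def field_simps)
    have wm: "w = ?n / real s * m" using sn by (simp add: m_def field_simps)
    have "\<bar>?n / real s * (a - m)\<bar> > \<epsilon> * (?n / real s * m)" using dev(2) ndev wm by simp
    then have "?n / real s * \<bar>a - m\<bar> > ?n / real s * (\<epsilon> * m)"
      using sn by (simp add: abs_mult mult_ac)
    then have "\<bar>a - m\<bar> > \<epsilon> * m" using sn by (simp only: mult_less_cancel_left_pos divide_pos_pos)
    then consider (up) "a > (1 + \<epsilon>) * m" | (low) "a < (1 - \<epsilon>) * m"
      by (auto simp: algebra_simps abs_if split: if_splits)
    then show ?thesis
    proof cases
      case up
      have "m \<le> (1 + \<epsilon>) * m" using eps m0 by (simp add: algebra_simps)
      with up have ma: "m \<le> a" by linarith
      show ?thesis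
      proof (rule *[OF \<delta>(1)])
        show "2 * \<mu>' \<le> \<delta>\<^sup>2" using \<delta>(2) \<mu>'_up[OF ma] m0 by linarith
        fix b :: nat assume "\<bar>real b - \<mu>'\<bar> < \<delta>"
        then have "real b \<le> m + \<delta>" using \<mu>'_up[OF ma] by linarith
        also have "\<dots> = (1 + \<epsilon> / 2) * m" by (simp add: \<delta>_def algebra_simps)
        also have "\<dots> \<le> ((1 - \<epsilon> / 4) * (1 + \<epsilon>)) * m"
        proof (rule mult_right_mono)
          have "\<epsilon> * \<epsilon> \<le> \<epsilon> * 1" using eps by (intro mult_left_mono) auto
          moreover have "(1 - \<epsilon> / 4) * (1 + \<epsilon>) = 1 + 3 / 4 * \<epsilon> - \<epsilon> * \<epsilon> / 4"
            by (simp add: field_simps)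
          ultimately show "1 + \<epsilon> / 2 \<le> (1 - \<epsilon> / 4) * (1 + \<epsilon>)" by linarith
        qed (use m0 in simp)
        also have "\<dots> = (1 - \<epsilon> / 4) * ((1 + \<epsilon>) * m)" by simp
        also have "\<dots> \<le> (1 - \<epsilon> / 4) * a" using up eps by (intro mult_left_mono) auto
        finally show "unbalanced \<epsilon> \<mu> (card (W \<inter> T)) b \<or> unbalanced \<epsilon> \<mu> b (card (W \<inter> T))"
          using ma m\<mu> \<mu>_ge by (auto simp: unbalanced_def a_def)
      qed
    next
      case low
      have "(1 - \<epsilon>) * m \<le> m" using eps m0 by (simp add: algebra_simps)
      with low have ma: "a \<le> m" by linarith
      have lo: "m \<le> \<mu>'"
      proof -
        have "m * (?n - real s) = (w - m) * real s" using m_n by (simp add: algebra_simps)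
        also have "\<dots> \<le> \<mu>' * (?n - real s)" unfolding \<mu>'_eq using ma sn by (intro mult_right_mono) auto
        finally show ?thesis using sn by simp
      qed
      \<comment> \<open>As 2s \<le> n, the ghost comes from at least half of the vertices, so its
        mean at most doubles.\<close>
      have hi: "\<mu>' \<le> 2 * m"
      proof -
        have "0 \<le> \<mu>'" by (simp add: \<mu>'_def)
        then have "\<mu>' * (?n / 2) \<le> \<mu>' * (?n - real s)" using sn by (intro mult_left_mono) auto
        also have "\<dots> \<le> w * real s" unfolding \<mu>'_eq using aw sn by (intro mult_right_mono) auto
        also have "\<dots> = 2 * m * (?n / 2)" using m_n by simp
        finally show ?thesis using sn by simp
      qed
      show ?thesis
      proof (rule *[OF \<delta>(1)])
        show "2 * \<mu>' \<le> \<delta>\<^sup>2" using \<delta>(2) hi by linarith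
        fix b :: nat assume "\<bar>real b - \<mu>'\<bar> < \<delta>"
        then have "m - \<delta> \<le> real b" using lo by linarith
        then have b: "(1 - \<epsilon> / 2) * m \<le> real b" by (simp add: \<delta>_def algebra_simps)
        have "\<epsilon> * m \<le> 1 * m" using eps m0 by (intro mult_right_mono) auto
        then have "m / 2 \<le> real b" using b by (simp add: algebra_simps)
        moreover have "a \<le> (1 - \<epsilon> / 4) * real b"
        proof -
          have "a \<le> (1 - \<epsilon>) * m" using low by simp
          also have "\<dots> \<le> ((1 - \<epsilon> / 4) * (1 - \<epsilon> / 2)) * m"
          proof (rule mult_right_mono)
            show "1 - \<epsilon> \<le> (1 - \<epsilon> / 4) * (1 - \<epsilon> / 2)" using eps by (simp add: algebra_simps)
          qed (use m0 in simp)
          also have "\<dots> = (1 - \<epsilon> / 4) * ((1 - \<epsilon> / 2) * m)" by simp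
          also have "\<dots> \<le> (1 - \<epsilon> / 4) * real b" using b eps by (intro mult_left_mono) auto
          finally show ?thesis .
        qed
        ultimately show "unbalanced \<epsilon> \<mu> (card (W \<inter> T)) b \<or> unbalanced \<epsilon> \<mu> b (card (W \<inter> T))"
          using m\<mu> by (auto simp: unbalanced_def a_def)
      qed
    qed
  qed
qed

lemma not_bad_imp_vertex_sample_set:
  assumes T: "T \<in> nsub V s" and good: "\<And>W. W \<in> cut_sides V E (card (nbhd V E W)) \<Longrightarrow>
      card (nbhd V E W) \<ge> 1 \<Longrightarrow> \<not> bad T W"
  shows "vertex_sample_set V E \<epsilon> \<phi>' T"
proof -
  have T': "T \<subseteq> V" "card T = s" "finite T"
    using T finite_V by (auto simp: nsub_def intro: finite_subset)
  then have "T \<noteq> {}" using s_pos by auto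
  show ?thesis
  proof (rule vertex_sample_setI[OF finite_V conn_V T'(1) \<open>T \<noteq> {}\<close>])
    fix W assume W: "W \<in> cut_sides V E (card (nbhd V E W))" "card (nbhd V E W) \<ge> 1"
      and sp: "vertex_sparsity V E W \<le> \<phi>' \<or>
        terminal_sparsity V E T W \<le> ereal (real (card V) / real (card T) * (\<phi>' / 10))"
    let ?N = "nbhd V E W"
    let ?k = "real (card ?N)" and ?n = "real (card V)"
    let ?d = "real (card (W \<union> ?N))"
    have k: "?k \<ge> 1" using W(2) by simp
    have WN: "W \<subseteq> V" "?N \<subseteq> V" using W by (auto simp: cut_sides_def nbhd_def)
    then have fin: "finite W" "finite ?N" using finite_V finite_subset by auto
    have d: "?d = real (card W) + ?k"
      using fin by (subst card_Un_disjoint) (auto simp: nbhd_def)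
    have n0: "?n > 0" using s_pos two_s by simp
    \<comment> \<open>The 10 in the definition of sample sets yields 10kM terminals in the closed
      side. At most k \<le> kM of them lie in the boundary, which leaves the 9kM of
      \<open>bad\<close>.\<close>
    have small: "terminal_sparsity V E T W > ereal (?n / real (card T) * (\<phi>' / 10))"
      if "real (card W) < ?k / \<phi>'"
    proof (rule ccontr)
      assume neg: "\<not> ?thesis"
      let ?t = "real (card ((W \<union> ?N) \<inter> T))"
      have t0: "?t > 0" and t: "?k / ?t \<le> ?n / real s * (\<phi>' / 10)"
        using neg T' by (auto simp: terminal_sparsity_def not_less split: if_splits)
      have "?k \<le> ?n / real s * (\<phi>' / 10) * ?t" using t t0 by (simp only: pos_divide_le_eq)
      then have "10 * M * ?k \<le> 10 * M * (?n / real s * (\<phi>' / 10) * ?t)"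
        using M_ge by (intro mult_left_mono) auto
      then have "10 * (?k * M) \<le> M * ?n * \<phi>' / real s * ?t" by (simp add: mult_ac)
      also have "M * ?n * \<phi>' / real s = 1" using n0 phi s_pos by (simp add: M_def)
      finally have "10 * (?k * M) \<le> ?t" by simp
      moreover have "?t \<le> real (card (W \<inter> T)) + ?k"
      proof -
        have "card ((W \<union> ?N) \<inter> T) \<le> card ((W \<inter> T) \<union> ?N)"
          using fin by (intro card_mono) auto
        also have "\<dots> \<le> card (W \<inter> T) + card ?N" by (rule card_Un_le)
        finally show ?thesis by linarith
      qed
      moreover have "?k \<le> ?k * M" using k M_ge by (simp add: mult_le_cancel_left1)
      ultimately have "9 * (?k * M) \<le> real (card (W \<inter> T))" by linarith
      with that good[OF W] show False by (auto simp: bad_def)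
    qed
    have large: "?k / (2 * \<phi>') \<le> real (card W)" if "\<not> real (card W) < ?k / \<phi>'"
    proof -
      have "?k / (2 * \<phi>') \<le> ?k / \<phi>'" using phi k by (simp add: frac_le)
      then show ?thesis using that by linarith
    qed
    \<comment> \<open>The closed side has at least k/\<phi>' vertices, and because \<phi>' < 1/2 its
      k boundary vertices make up at most half of that. Hence the 2 in \<open>bad\<close>.\<close>
    have "?k / (2 * \<phi>') \<le> real (card W)" if "vertex_sparsity V E W \<le> \<phi>'"
    proof -
      have "?k \<le> \<phi>' * (real (card W) + ?k)" using that k d
        by (simp add: vertex_sparsity_def divide_simps)
      then have "?k / \<phi>' \<le> real (card W) + ?k" using phi by (simp add: field_simps)
      moreover have "?k * (2 * \<phi>') \<le> ?k * 1" using k phi by (intro mult_left_mono) auto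
      then have "?k \<le> ?k / (2 * \<phi>')" using phi by (simp add: field_simps)
      moreover have "?k / \<phi>' = 2 * (?k / (2 * \<phi>'))" by simp
      ultimately show ?thesis by linarith
    qed
    with sp small large have "?k / (2 * \<phi>') \<le> real (card W)" by (meson not_less)
    then show "\<bar>?n / real (card T) * real (card (W \<inter> T)) - real (card W)\<bar> \<le> \<epsilon> * real (card W)"
      using good[OF W] T'(2) by (auto simp: bad_def)
  qed (use eps in simp)
qed

lemma card_not_vertex_sample_set:
  "real (card {T \<in> nsub V s. \<not> vertex_sample_set V E \<epsilon> \<phi>' T}) \<le> 1 / 2 * real (card V choose s)"
proof -
  have "real (card {T \<in> nsub V s. \<not> vertex_sample_set V E \<epsilon> \<phi>' T}) \<le> 2 * (1 / 4) * real (card V choose s)"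
  proof (rule nsub_ghost_sample[OF finite_V two_s, where Q = unbalanced_pair])
    fix T assume T: "T \<in> nsub V s" "\<not> vertex_sample_set V E \<epsilon> \<phi>' T"
    then obtain W where "W \<in> cut_sides V E (card (nbhd V E W))" "card (nbhd V E W) \<ge> 1" "bad T W"
      using not_bad_imp_vertex_sample_set by blast
    then show "real (card (nsub (V - T) s))
        \<le> 2 * real (card {T' \<in> nsub (V - T) s. unbalanced_pair T T'})"
      by (intro bad_imp_unbalanced_pairs[OF T(1)])
  qed (use card_unbalanced_pair in auto)
  then show ?thesis by simp
qed

end

section \<open>Calibration of the sample size\<close>

text \<open>The estimates call for x (1 + L), while the sample size is max 1 (xL). If L < 1, the 1
  suffices up to a constant, because x \<le> exp L \<le> 3; the first inequality holds since
  \<epsilon>^3 \<le> \<epsilon>^2. The last bound makes ln s at most 2L plus a constant, so the tail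
  can absorb the number of traces.\<close>

lemma sample_size_bounds:
  assumes "0 < \<epsilon>" "\<epsilon> < 1" "real n * \<phi>' \<ge> 1" "0 < \<phi>'"
  defines "x \<equiv> real n * \<phi>' / \<epsilon>\<^sup>2" and "L \<equiv> ln (real n * \<phi>' / \<epsilon> ^ 3)"
  shows "L \<ge> 0" "x \<ge> 1" "x * (1 + L) \<le> 6 * sample_size n \<epsilon> \<phi>'" "sample_size n \<epsilon> \<phi>' \<le> exp (2 * L)"
proof -
  let ?K = "real n * \<phi>'" and ?S = "sample_size n \<epsilon> \<phi>'"
  have e: "0 < \<epsilon>\<^sup>2" "\<epsilon>\<^sup>2 \<le> 1" "0 < \<epsilon> ^ 3" "\<epsilon> ^ 3 \<le> \<epsilon>\<^sup>2"
    using assms(1,2) by (auto simp: power_le_one power_decreasing)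
  then show x1: "x \<ge> 1" using assms(3) by (simp add: x_def)
  have xe: "x \<le> ?K / \<epsilon> ^ 3" using e assms(3) by (simp add: x_def frac_le)
  then have expL: "exp L = ?K / \<epsilon> ^ 3" using x1 by (simp add: L_def)
  show L0: "L \<ge> 0" unfolding L_def using xe x1 by (intro ln_ge_zero) linarith
  have S: "?S = max 1 (x * L)" using assms(4) by (simp add: sample_size_def x_def L_def)
  have xL: "x \<le> exp L" using xe expL by simp
  show "x * (1 + L) \<le> 6 * ?S"
  proof (cases "L \<ge> 1")
    case True
    then have "x * 1 \<le> x * L" using x1 by (intro mult_left_mono) auto
    then have "x * (1 + L) \<le> 2 * (x * L)" by (simp add: algebra_simps)
    also have "\<dots> \<le> 6 * ?S"
    proof -
      have "1 \<le> ?S" "x * L \<le> ?S" by (simp_all add: S)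
      then show ?thesis by linarith
    qed
    finally show ?thesis .
  next
    case False
    have "exp L \<le> exp 1" using False by simp
    also have "\<dots> \<le> 3" by (rule exp_le)
    finally have "x \<le> 3" using xL by simp
    then have "x * (1 + L) \<le> 3 * 2" using False L0 x1 by (intro mult_mono) auto
    also have "\<dots> \<le> 6 * ?S" using S by simp
    finally show ?thesis .
  qed
  have "L \<le> exp L" using exp_ge_add_one_self[of L] by linarith
  then have "x * L \<le> exp L * exp L" using xL L0 by (intro mult_mono) auto
  also have "\<dots> = exp (2 * L)" by (simp add: exp_add[symmetric])
  finally show "?S \<le> exp (2 * L)" using S L0 by simp
qed

text \<open>The constant \<open>2 ^ 22\<close> outweighs the factor \<open>1 / 2400\<close> in the tail bound and the exponent 5 in the
  number of traces.\<close>

definition base_size :: "nat \<Rightarrow> real \<Rightarrow> real \<Rightarrow> nat" where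
  "base_size n \<epsilon> \<phi>' = nat \<lceil>4194304 * sample_size n \<epsilon> \<phi>'\<rceil>"

lemma base_size_bounds:
  shows "4194304 * sample_size n \<epsilon> \<phi>' \<le> real (base_size n \<epsilon> \<phi>')"
    and "real (base_size n \<epsilon> \<phi>') \<le> 8388608 * sample_size n \<epsilon> \<phi>'"
proof -
  have "1 \<le> sample_size n \<epsilon> \<phi>'" by (simp add: sample_size_def)
  then show "4194304 * sample_size n \<epsilon> \<phi>' \<le> real (base_size n \<epsilon> \<phi>')"
    and "real (base_size n \<epsilon> \<phi>') \<le> 8388608 * sample_size n \<epsilon> \<phi>'"
    unfolding base_size_def by linarith+
qed

lemma sampling_base_size:
  assumes "finite V" "conn E V" "0 < \<epsilon>" "\<epsilon> < 1" "0 < \<phi>'" "\<phi>' < 1 / 2"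
    and K: "1 \<le> real (card V) * \<phi>'" and s: "s = base_size (card V) \<epsilon> \<phi>'" "2 * s \<le> card V"
  shows "sampling V E \<epsilon> \<phi>' s"
proof -
  let ?n = "card V"
  let ?K = "real ?n * \<phi>'" and ?S = "sample_size ?n \<epsilon> \<phi>'"
  define x where "x = ?K / \<epsilon>\<^sup>2"
  define L where "L = ln (?K / \<epsilon> ^ 3)"
  note b = sample_size_bounds[OF assms(3,4) K assms(5), folded x_def L_def]
  have s_ge: "4194304 * ?S \<le> real s" and s_le: "real s \<le> 8388608 * ?S"
    using base_size_bounds[where n = ?n] by (simp_all add: s(1))
  define z where "z = \<epsilon>\<^sup>2 * (real s / ?K)"
  have M: "z = real s / x" using assms(3) by (simp add: x_def z_def)
  have "0 \<le> x * (1 + L)" using b(1,2) by (intro mult_nonneg_nonneg) auto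
  \<comment> \<open>4194304 / 6 exceeds 600000, and 600000 / 2400 = 250 leaves an exponent of at
    least 200 + 10L. The 10L cancels the growth of s^5, and exp (-200) outweighs 48 * 32 *
    2^115.\<close>
  then have "600000 * (x * (1 + L)) \<le> real s" using b(3) s_ge by linarith
  then have dense: "600000 * (1 + L) \<le> z"
    unfolding M using b(2) by (simp only: pos_le_divide_eq) (simp add: mult_ac)
  have z32: "32 \<le> z" using dense b(1) by (simp add: distrib_left)
  have "real s \<le> 8388608 * exp (2 * L)" using s_le b(4) by linarith
  then have "real s ^ 5 \<le> (8388608 * exp (2 * L)) ^ 5" by (intro power_mono) auto
  also have "\<dots> = 2 ^ 115 * exp (10 * L)"
    by (simp add: power_mult_distrib exp_of_nat_mult[symmetric] flip: exp_of_nat_mult)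
  finally have s5: "real s ^ 5 \<le> 2 ^ 115 * exp (10 * L)" .
  have "exp (- (z / 2400)) \<le> exp (- 200 + - (10 * L))"
  proof -
    have "200 + 10 * L \<le> z / 2400"
    proof -
      have "200 + 10 * L \<le> 600000 * (1 + L) / 2400" using b(1) by simp
      also have "\<dots> \<le> z / 2400" using dense by (rule divide_right_mono) simp
      finally show ?thesis .
    qed
    then show ?thesis by simp
  qed
  also have "\<dots> = exp (- 200) * exp (- (10 * L))" by (rule exp_add)
  also have "\<dots> \<le> (1 / 2) ^ 200 * exp (- (10 * L))"
  proof (rule mult_right_mono)
    have "(2::real) \<le> exp 1" using exp_ge_add_one_self[of 1] by simp
    then have "(2::real) ^ 200 \<le> exp 1 ^ 200" by (rule power_mono) simp
    also have "\<dots> = exp 200" by (simp flip: exp_of_nat_mult)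
    finally show "exp (- 200) \<le> (1 / 2 :: real) ^ 200" by (simp add: exp_minus field_simps)
  qed simp
  finally have "48 * (2 * real s) ^ 5 * exp (- (z / 2400))
      \<le> 48 * (32 * (2 ^ 115 * exp (10 * L))) * ((1 / 2) ^ 200 * exp (- (10 * L)))"
    using s5 by (intro mult_mono) (auto simp: power_mult_distrib)
  also have "\<dots> = (48 * 32 * 2 ^ 115 * (1 / 2) ^ 200) * (exp (10 * L) * exp (- (10 * L)))"
    by (simp only: mult_ac)
  also have "exp (10 * L) * exp (- (10 * L)) = 1" by (simp flip: exp_add)
  also have "(48 * 32 * 2 ^ 115 * (1 / 2) ^ 200) * 1 \<le> (1 / 16 :: real)" by (simp add: power_one_over)
  finally show ?thesis
    using assms z32 unfolding z_def by unfold_locales auto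
qed

lemma connected_graph_conn: "connected_graph V E \<Longrightarrow> conn E V"
  by (simp add: connected_graph_def conn_def)

lemma connected_graph_finite: "connected_graph V E \<Longrightarrow> finite V \<and> V \<noteq> {}"
  by (simp add: connected_graph_def simple_graph_def)

text \<open>This is \<open>min s n\<close> for the size function \<open>s\<close> that is \<open>b\<close> if \<open>2 * b \<le> n\<close> and \<open>2 * b\<close> otherwise.
  A ghost sample fits into the graph in the first case; in the second all vertices are taken.\<close>

definition capped_size :: "nat \<Rightarrow> nat \<Rightarrow> nat" where
  "capped_size n b = (if n < 2 * b then n else b)"

text \<open>If n\<phi>' < 1, every nonempty set is good. If two disjoint samples of the base size do
  not fit into \<open>V\<close>, the sample is \<open>V\<close> itself. The ghost argument covers
  what remains.\<close>

lemma half_samples_good: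
  assumes G: "connected_graph V E" and "0 < \<epsilon>" "\<epsilon> < 1" "\<phi>' < 1 / 2"
    and k: "k = capped_size (card V) (base_size (card V) \<epsilon> \<phi>')"
  shows "real (card {T \<in> nsub V k. \<not> vertex_sample_set V E \<epsilon> \<phi>' T}) \<le> 1 / 2 * real (card V choose k)"
proof -
  let ?n = "card V" and ?b = "base_size (card V) \<epsilon> \<phi>'"
  note V = connected_graph_finite[OF G] connected_graph_conn[OF G]
  have "?n \<ge> 1" using V(1) by (simp add: Suc_le_eq card_gt_0_iff)
  moreover have "1 \<le> sample_size ?n \<epsilon> \<phi>'" by (simp add: sample_size_def)
  then have "?b \<ge> 1" using base_size_bounds(1)[of ?n \<epsilon> \<phi>'] by linarith
  ultimately have k1: "k \<ge> 1" by (simp add: k capped_size_def)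
  consider (triv) "real ?n * \<phi>' < 1" | (all) "?n < 2 * ?b" | (samp) "1 \<le> real ?n * \<phi>'" "2 * ?b \<le> ?n"
    by linarith
  then show ?thesis
  proof cases
    case triv
    have "vertex_sample_set V E \<epsilon> \<phi>' T" if "T \<in> nsub V k" for T
      using that k1 triv V assms by (intro vertex_sample_set_trivial) (auto simp: nsub_def)
    then have *: "{T \<in> nsub V k. \<not> vertex_sample_set V E \<epsilon> \<phi>' T} = {}" by blast
    show ?thesis unfolding * by simp
  next
    case all
    then have "T = V" if "T \<in> nsub V k" for T
      using that V(1) by (auto simp: nsub_def k capped_size_def card_subset_eq)
    then have *: "{T \<in> nsub V k. \<not> vertex_sample_set V E \<epsilon> \<phi>' T} = {}"
      using vertex_sample_set_whole[of V \<epsilon> E \<phi>'] V(1) assms(2) by fastforce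
    show ?thesis unfolding * by simp
  next
    case samp
    then have "\<phi>' > 0" by (smt (verit) mult_nonneg_nonpos of_nat_0_le_iff)
    then have "sampling V E \<epsilon> \<phi>' ?b"
      using V assms samp by (intro sampling_base_size) auto
    then interpret sampling V E \<epsilon> \<phi>' ?b "real ?b / (real ?n * \<phi>')" .
    show ?thesis using card_not_vertex_sample_set samp(2) by (simp add: k capped_size_def)
  qed
qed

text \<open>With at least two vertices none is isolated, so the edges cover \<open>V\<close>. This
  converts a running time linear in n into one linear in m; the 1 accounts for a single
  vertex.\<close>

lemma connected_graph_card_le:
  assumes "connected_graph V E"
  shows "card V \<le> 2 * card E + 1"
proof (cases "card V \<le> 1")
  case False
  have fin: "finite V" using connected_graph_finite[OF assms] by simp
  have E: "E \<subseteq> {{u, v} |u v. u \<in> V \<and> v \<in> V \<and> u \<noteq> v}"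
    using assms by (simp add: connected_graph_def simple_graph_def)
  have finE: "finite E"
    by (rule finite_subset[of _ "Pow V"]) (use E fin in auto)
  have "V \<subseteq> \<Union> E"
  proof
    fix u assume u: "u \<in> V"
    have "V \<noteq> {u}" using False by auto
    with u obtain v where v: "v \<in> V" "v \<noteq> u" by auto
    have "(u, v) \<in> (induced_adj E V)\<^sup>*" using assms u v by (simp add: connected_graph_def)
    then obtain z where "(u, z) \<in> induced_adj E V" using v(2) by (auto elim: converse_rtranclE)
    then show "u \<in> \<Union> E" by (auto simp: induced_adj_def)
  qed
  moreover have fu: "finite (\<Union> E)" using E fin by (auto intro: finite_subset[of _ V])
  ultimately have "card V \<le> card (\<Union> E)" by (intro card_mono)
  also have "\<dots> \<le> (\<Sum>e\<in>E. card e)" by (rule card_Union_le_sum_card)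
  also have "\<dots> \<le> (\<Sum>e\<in>E. 2)" using E by (intro sum_mono) (auto simp: card_insert_if)
  finally show ?thesis by simp
qed simp

section \<open>The sampling program\<close>

lemma nsub_nonempty: "finite U \<Longrightarrow> m \<le> card U \<Longrightarrow> nsub U m \<noteq> {}"
  by (metis card_nsub card.empty binomial_eq_0_iff not_less)

text \<open>Selection sampling: the next candidate is taken with probability (missing elements) /
  (remaining candidates).\<close>

lemma pmf_of_set_nsub_insert:
  assumes "finite U" "v \<notin> U" "m \<le> Suc (card U)"
  shows "pmf_of_set (nsub (insert v U) m) =
    bind_pmf (pmf_of_set {0..<Suc (card U)})
      (\<lambda>r. if r < m then map_pmf (insert v) (pmf_of_set (nsub U (m - 1))) else pmf_of_set (nsub U m))"
    (is "?lhs = ?rhs")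
proof (rule pmf_eqI)
  fix T
  let ?u = "card U"
  define a where "a = pmf (map_pmf (insert v) (pmf_of_set (nsub U (m - 1)))) T"
  define b where "b = pmf (pmf_of_set (nsub U m)) T"
  have fin: "finite (nsub W k)" if "W \<subseteq> insert v U" for W k
    using that assms(1) by (meson finite_insert finite_nsub finite_subset)
  have lhs: "pmf ?lhs T = indicator (nsub (insert v U) m) T / real (Suc ?u choose m)"
    using assms fin nsub_nonempty[of "insert v U" m] by (subst pmf_of_set) (auto simp: card_nsub)
  have "pmf ?rhs T = (\<Sum>r\<in>{0..<Suc ?u}. if r < m then a else b) / real (Suc ?u)"
    by (simp add: pmf_bind integral_pmf_of_set a_def b_def if_distrib[of "\<lambda>p. pmf p T"] cong: if_cong)
  also have "(\<Sum>r\<in>{0..<Suc ?u}. if r < m then a else b) = real m * a + real (Suc ?u - m) * b"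
  proof -
    have "{0..<Suc ?u} \<inter> {r. r < m} = {0..<m}" "{0..<Suc ?u} \<inter> - {r. r < m} = {m..<Suc ?u}"
      using assms(3) by auto
    then show ?thesis by (simp only: sum.If_cases finite_atLeastLessThan sum_constant) simp
  qed
  finally have rhs: "pmf ?rhs T = (real m * a + real (Suc ?u - m) * b) / real (Suc ?u)" .
  \<comment> \<open>For \<open>m = 0\<close> the truncated \<open>m - 1\<close> makes
    \<open>a\<close> meaningless, but its weight is 0.\<close>
  have a: "real m * a = (if v \<in> T \<and> T \<in> nsub (insert v U) m then real m / real (?u choose (m - 1)) else 0)"
  proof (cases m)
    case (Suc m')
    have ne: "nsub U m' \<noteq> {}" using assms Suc by (intro nsub_nonempty) auto
    have inj: "inj_on (insert v) (nsub U m')"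
      using assms(2) by (intro inj_onI) (auto simp: nsub_def)
    have img: "insert v ` nsub U m' = {T \<in> nsub (insert v U) m. v \<in> T}"
    proof (intro equalityI subsetI)
      fix X assume "X \<in> insert v ` nsub U m'"
      then obtain Y where "X = insert v Y" "Y \<subseteq> U" "card Y = m'" by (auto simp: nsub_def)
      moreover from this have "finite Y" "v \<notin> Y" using assms finite_subset by auto
      ultimately show "X \<in> {T \<in> nsub (insert v U) m. v \<in> T}" by (auto simp: nsub_def Suc)
    next
      fix X assume X: "X \<in> {T \<in> nsub (insert v U) m. v \<in> T}"
      then show "X \<in> insert v ` nsub U m'"
        by (intro image_eqI[of _ _ "X - {v}"]) (auto simp: nsub_def Suc)
    qed
    have "a = indicator (insert v ` nsub U m') T / real (card (insert v ` nsub U m'))"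
      unfolding a_def using ne finite_nsub[OF assms(1), of m'] inj Suc by (simp add: map_pmf_of_set_inj)
    also have "card (insert v ` nsub U m') = ?u choose m'"
      using inj assms by (simp add: card_image card_nsub)
    finally show ?thesis by (auto simp: img Suc indicator_def)
  qed simp
  \<comment> \<open>For \<open>m = Suc ?u\<close> the set \<open>nsub U m\<close> is empty and
    \<open>b\<close> is unspecified; again the weight is 0.\<close>
  have b: "real (Suc ?u - m) * b =
      (if v \<notin> T \<and> T \<in> nsub (insert v U) m then real (Suc ?u - m) / real (?u choose m) else 0)"
  proof (cases "m \<le> ?u")
    case True
    have "b = indicator (nsub U m) T / real (?u choose m)"
      unfolding b_def using nsub_nonempty[OF assms(1) True] fin[of U m] assms
      by (subst pmf_of_set) (auto simp: card_nsub)
    moreover have "T \<in> nsub U m \<longleftrightarrow> v \<notin> T \<and> T \<in> nsub (insert v U) m"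
      using assms(2) by (auto simp: nsub_def)
    ultimately show ?thesis by simp
  qed simp
  have pos: "real (Suc ?u choose m) > 0" using assms(3) by (simp add: zero_less_binomial_iff)
  \<comment> \<open>By the two absorption identities for binomial coefficients, both branches give
    each set the same weight.\<close>
  have 1: "real m / real (?u choose (m - 1)) / real (Suc ?u) = 1 / real (Suc ?u choose m)" if "m > 0"
  proof -
    have "m * (Suc ?u choose m) = Suc ?u * (?u choose (m - 1))"
      using times_binomial_minus1_eq[OF that, of "Suc ?u"] by simp
    then have "real m * real (Suc ?u choose m) = real (Suc ?u) * real (?u choose (m - 1))"
      by (metis of_nat_mult)
    moreover have "real (?u choose (m - 1)) > 0" using assms(3) that by (simp add: zero_less_binomial_iff)
    ultimately show ?thesis using pos by (simp add: field_simps del: of_nat_Suc binomial_Suc_Suc)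
  qed
  have 2: "real (Suc ?u - m) / real (?u choose m) / real (Suc ?u) = 1 / real (Suc ?u choose m)" if "m \<le> ?u"
  proof -
    have "(Suc ?u - m) * (Suc ?u choose m) = Suc ?u * (?u choose m)"
      using binomial_absorb_comp[of "Suc ?u" m] by simp
    then have "real (Suc ?u - m) * real (Suc ?u choose m) = real (Suc ?u) * real (?u choose m)"
      by (metis of_nat_mult)
    moreover have "real (?u choose m) > 0" using that by (simp add: zero_less_binomial_iff)
    ultimately show ?thesis using pos by (simp add: field_simps del: of_nat_Suc binomial_Suc_Suc of_nat_diff)
  qed
  have m0: "m > 0" if "v \<in> T" "T \<in> nsub (insert v U) m"
    using that finite_subset[of T "insert v U"] assms(1) by (auto simp: nsub_def card_gt_0_iff)
  have mu: "m \<le> ?u" if "v \<notin> T" "T \<in> nsub (insert v U) m"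
  proof -
    have "T \<subseteq> U" "card T = m" using that by (auto simp: nsub_def)
    then show ?thesis using card_mono[OF assms(1)] by blast
  qed
  show "pmf ?lhs T = pmf ?rhs T"
    unfolding lhs rhs a b using 1[OF m0] 2[OF mu] by auto
qed

text \<open>
  Positions 0 to 16 put the real sample size into real register 2, positions 17 to 23 count
  register 2 up to the number of samples, and the loop from position 26 on is selection sampling
  over the candidates in register 4, with the number of missing elements in register 8.
  The edges are never read.
\<close>

definition sampler :: "instr list" where
  "sampler = [
    WConst 3 1,
    WLoad 1 0,
    WConst 5 4194304,
    ROfWord 2 5,
    RJumpLess 9 1 6,
    Jump 17,
    ROfWord 3 1,
    RMul 3 3 1,
    RDiv 4 3 0,
    RDiv 4 4 0,
    RDiv 5 4 0,
    RLn 5 5,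
    RMul 4 4 5,
    RMul 4 4 2,
    RJumpLess 2 4 16,
    Jump 17,
    RAdd 2 4 9,
    WAdd 2 2 3,
    WAdd 6 2 2,
    WJumpLess 1 6 23,
    ROfWord 6 2,
    RJumpLess 6 2 17,
    Jump 24,
    WAdd 2 1 0,
    WStore 0 2,
    WAdd 8 2 0,
    WSub 5 1 4,
    WRand 5 5,
    WJumpLess 5 8 30,
    Jump 32,
    WStore 8 4,
    WSub 8 8 3,
    WAdd 4 4 3,
    WJumpLess 4 1 26]"

lemma length_sampler: "length sampler = 34"
  by (simp add: sampler_def)

section \<open>Deterministic stretches of a run\<close>

text \<open>\<open>T\<close> is only an upper bound because branches differ in length. Quantifying
  over the remaining steps \<open>b\<close> allows the continuation to be random.\<close>

definition reach :: "nat \<Rightarrow> nat \<Rightarrow> config \<Rightarrow> config \<Rightarrow> bool" where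
  "reach w T c c' \<longleftrightarrow> (\<exists>t\<le>T. \<forall>b. run w sampler (t + b) c = run w sampler b c')"

lemma reach_refl: "reach w T c c"
  unfolding reach_def by (intro exI[of _ 0]) auto

lemma reach_trans: "reach w T c c' \<Longrightarrow> reach w T' c' c'' \<Longrightarrow> reach w (T + T') c c''"
  unfolding reach_def by (metis add.assoc add_mono)

lemma reach_mono: "reach w T c c' \<Longrightarrow> T \<le> T' \<Longrightarrow> reach w T' c c'"
  unfolding reach_def by (meson order_trans)

lemma reach_run:
  assumes "reach w T c c'" "T \<le> b"
  obtains b' where "b - T \<le> b'" "run w sampler b c = run w sampler b' c'"
proof -
  obtain t where "t \<le> T" "\<And>b. run w sampler (t + b) c = run w sampler b c'"
    using assms by (auto simp: reach_def)
  then show ?thesis using that[of "b - t"] assms(2) by (metis diff_le_mono2 le_add_diff_inverse le_trans)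
qed

text \<open>An executable copy of the deterministic instructions that the program uses, meant for
  symbolic execution. \<open>None\<close> marks all others, among them \<open>WRand\<close>.\<close>

fun det_exec :: "nat \<Rightarrow> instr \<Rightarrow> config \<Rightarrow> config option" where
  "det_exec w (WConst d k) c = Some (set_word w d k c)"
| "det_exec w (WAdd d a b) c = Some (set_word w d (wreg c a + wreg c b) c)"
| "det_exec w (WSub d a b) c = Some (set_word w d (wreg c a - wreg c b) c)"
| "det_exec w (WLoad d a) c = Some (set_word w d (mem c (wreg c a)) c)"
| "det_exec w (WStore a b) c = Some (next_pc (c\<lparr>mem := (mem c)(wreg c a := wreg c b)\<rparr>))"
| "det_exec w (Jump l) c = Some (c\<lparr>pc := l\<rparr>)"
| "det_exec w (WJumpLess a b l) c = Some (if wreg c a < wreg c b then c\<lparr>pc := l\<rparr> else next_pc c)"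
| "det_exec w (ROfWord d a) c = Some (set_real d (real (wreg c a)) c)"
| "det_exec w (RAdd d a b) c = Some (set_real d (rreg c a + rreg c b) c)"
| "det_exec w (RMul d a b) c = Some (set_real d (rreg c a * rreg c b) c)"
| "det_exec w (RDiv d a b) c = Some (set_real d (rreg c a / rreg c b) c)"
| "det_exec w (RLn d a) c = Some (set_real d (ln (rreg c a)) c)"
| "det_exec w (RJumpLess a b l) c = Some (if rreg c a < rreg c b then c\<lparr>pc := l\<rparr> else next_pc c)"
| "det_exec w _ c = None"

lemma det_exec: "det_exec w i c = Some c' \<Longrightarrow> exec_instr w i c = return_pmf c'"
  by (cases "(w, i, c)" rule: det_exec.cases) (auto split: if_splits)

text \<open>Used as a conditional rewrite rule, this executes one instruction and recurs on the
  smaller budget until \<open>reach_refl\<close> applies.\<close>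

lemma reach_step:
  assumes "pc c < 34" "det_exec w (sampler ! pc c) c \<noteq> None"
    "reach w (T - 1) (the (det_exec w (sampler ! pc c) c)) c'" "0 < T"
  shows "reach w T c c'"
proof -
  obtain c1 where c1: "det_exec w (sampler ! pc c) c = Some c1" using assms(2) by auto
  then have "run w sampler (Suc b) c = run w sampler b c1" for b
    using assms(1) det_exec[OF c1] by (simp add: step_def halted_def length_sampler bind_return_pmf)
  moreover obtain t where t: "t \<le> T - 1" "\<And>b. run w sampler (t + b) c1 = run w sampler b c'"
    using assms(3) c1 by (auto simp: reach_def)
  ultimately show ?thesis
    unfolding reach_def using assms(4) by (intro exI[of _ "Suc t"]) auto
qed

lemma sampler_nth:
  "sampler ! 0 = WConst 3 1"
  "sampler ! Suc 0 = WLoad 1 0"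
  "sampler ! 2 = WConst 5 4194304"
  "sampler ! 3 = ROfWord 2 5"
  "sampler ! 4 = RJumpLess 9 1 6"
  "sampler ! 5 = Jump 17"
  "sampler ! 6 = ROfWord 3 1"
  "sampler ! 7 = RMul 3 3 1"
  "sampler ! 8 = RDiv 4 3 0"
  "sampler ! 9 = RDiv 4 4 0"
  "sampler ! 10 = RDiv 5 4 0"
  "sampler ! 11 = RLn 5 5"
  "sampler ! 12 = RMul 4 4 5"
  "sampler ! 13 = RMul 4 4 2"
  "sampler ! 14 = RJumpLess 2 4 16"
  "sampler ! 15 = Jump 17"
  "sampler ! 16 = RAdd 2 4 9"
  "sampler ! 17 = WAdd 2 2 3"
  "sampler ! 18 = WAdd 6 2 2"
  "sampler ! 19 = WJumpLess 1 6 23"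
  "sampler ! 20 = ROfWord 6 2"
  "sampler ! 21 = RJumpLess 6 2 17"
  "sampler ! 22 = Jump 24"
  "sampler ! 23 = WAdd 2 1 0"
  "sampler ! 24 = WStore 0 2"
  "sampler ! 25 = WAdd 8 2 0"
  "sampler ! 26 = WSub 5 1 4"
  "sampler ! 27 = WRand 5 5"
  "sampler ! 28 = WJumpLess 5 8 30"
  "sampler ! 29 = Jump 32"
  "sampler ! 30 = WStore 8 4"
  "sampler ! 31 = WSub 8 8 3"
  "sampler ! 32 = WAdd 4 4 3"
  "sampler ! 33 = WJumpLess 4 1 26"
  by (simp_all add: sampler_def)

lemmas step_simps = reach_refl reach_step sampler_nth set_word_def set_real_def next_pc_def numeral_2_eq_2[symmetric]

lemma run_halted: "34 \<le> pc c \<Longrightarrow> run w sampler b c = return_pmf c"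
  by (induction b) (auto simp: step_def halted_def length_sampler bind_return_pmf)

section \<open>Correctness of the program\<close>

text \<open>Reals cannot be rounded to words, so the ceiling is found by counting, with the
  invariant \<open>real j < R 2\<close> and \<open>2 * j \<le> n\<close>. The cap is tested before
  the reals are compared; this bounds the number of rounds and excludes overflow however large the
  real is.\<close>

lemma count_loop:
  assumes "W 0 = 0" "W 1 = n" "W 2 = j" "W 3 = 1" "W 4 = 0" "real j < R 2" "2 * j \<le> n" "2 * n + 2 < 2 ^ w"
  shows "\<exists>W' R'. reach w (6 * (n - j) + 6) \<lparr>pc = 17, wreg = W, mem = m, rreg = R\<rparr>
           \<lparr>pc = 24, wreg = W', mem = m, rreg = R'\<rparr> \<and>
         W' 0 = 0 \<and> W' 1 = n \<and> W' 2 = capped_size n (nat \<lceil>R 2\<rceil>) \<and> W' 3 = 1 \<and> W' 4 = 0"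
  using assms
proof (induction "n - j" arbitrary: j W R rule: less_induct)
  case less
  let ?W = "W(2 := j + 1, 6 := 2 * j + 2)"
  have mods: "(j + 1) mod 2 ^ w = j + 1" "(2 * j + 2) mod 2 ^ w = 2 * j + 2" "n mod 2 ^ w = n"
    using less.prems by auto
  have ge: "j + 1 \<le> nat \<lceil>R 2\<rceil>" using less.prems(6) by linarith
  consider (cap) "n < 2 * j + 2" | (more) "2 * j + 2 \<le> n" "real (j + 1) < R 2"
    | (stop) "2 * j + 2 \<le> n" "\<not> real (j + 1) < R 2" by linarith
  then show ?case
  proof cases
    case cap
    have "reach w 6 \<lparr>pc = 17, wreg = W, mem = m, rreg = R\<rparr>
        \<lparr>pc = 24, wreg = ?W(2 := n), mem = m, rreg = R\<rparr>"
      using less.prems cap mods by (simp add: step_simps mult_2 fun_upd_twist)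
    then have "reach w (6 * (n - j) + 6) \<lparr>pc = 17, wreg = W, mem = m, rreg = R\<rparr>
        \<lparr>pc = 24, wreg = ?W(2 := n), mem = m, rreg = R\<rparr>" by (rule reach_mono) simp
    moreover have "capped_size n (nat \<lceil>R 2\<rceil>) = n" using cap ge by (simp add: capped_size_def)
    ultimately show ?thesis using less.prems
      by (intro exI[of _ "?W(2 := n)"] exI[of _ R]) simp
  next
    case stop
    have "reach w 6 \<lparr>pc = 17, wreg = W, mem = m, rreg = R\<rparr>
        \<lparr>pc = 24, wreg = ?W, mem = m, rreg = R(6 := real (j + 1))\<rparr>"
      using less.prems stop mods by (simp add: step_simps mult_2)
    then have "reach w (6 * (n - j) + 6) \<lparr>pc = 17, wreg = W, mem = m, rreg = R\<rparr>
        \<lparr>pc = 24, wreg = ?W, mem = m, rreg = R(6 := real (j + 1))\<rparr>" by (rule reach_mono) simp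
    moreover have "capped_size n (nat \<lceil>R 2\<rceil>) = j + 1"
    proof -
      have "nat \<lceil>R 2\<rceil> = j + 1" using stop less.prems(6) ge by linarith
      then show ?thesis using stop by (simp add: capped_size_def)
    qed
    ultimately show ?thesis using less.prems
      by (intro exI[of _ ?W] exI[of _ "R(6 := real (j + 1))"]) simp
  next
    case more
    let ?R = "R(6 := real (j + 1))"
    have 1: "reach w 6 \<lparr>pc = 17, wreg = W, mem = m, rreg = R\<rparr>
        \<lparr>pc = 17, wreg = ?W, mem = m, rreg = ?R\<rparr>"
      using less.prems more mods by (simp add: step_simps mult_2)
    have "\<exists>W' R'. reach w (6 * (n - (j + 1)) + 6) \<lparr>pc = 17, wreg = ?W, mem = m, rreg = ?R\<rparr>
           \<lparr>pc = 24, wreg = W', mem = m, rreg = R'\<rparr> \<and>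
         W' 0 = 0 \<and> W' 1 = n \<and> W' 2 = capped_size n (nat \<lceil>?R 2\<rceil>) \<and> W' 3 = 1 \<and> W' 4 = 0"
      using less.prems more by (intro less.hyps) auto
    then obtain W' R' where 2: "reach w (6 * (n - (j + 1)) + 6)
           \<lparr>pc = 17, wreg = ?W, mem = m, rreg = ?R\<rparr> \<lparr>pc = 24, wreg = W', mem = m, rreg = R'\<rparr>"
      "W' 0 = 0" "W' 1 = n" "W' 2 = capped_size n (nat \<lceil>R 2\<rceil>)" "W' 3 = 1" "W' 4 = 0" by auto
    have "6 + (6 * (n - (j + 1)) + 6) = 6 * (n - j) + 6" using more by simp
    with reach_trans[OF 1 2(1)] 2(2-) show ?thesis by metis
  qed
qed

text \<open>Cells are filled from \<open>k\<close> downwards, and \<open>q\<close> elements are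
  missing, so the cells from q + 1 to k are final. The branches leave different budgets, hence an
  arbitrary \<open>T\<close> above the bound; surplus steps after halting do nothing.\<close>

lemma selection_loop:
  assumes "W 1 = n" "W 3 = 1" "W 4 = v" "W 8 = q" "v \<le> n" "q \<le> n - v" "q \<le> k" "n < 2 ^ w" "8 * (n - v) \<le> T"
  shows "map_pmf (\<lambda>c. (34 \<le> pc c, mem c 0, mem c ` {1..k}))
      (run w sampler T \<lparr>pc = if v < n then 26 else 34, wreg = W, mem = m, rreg = R\<rparr>) =
    map_pmf (\<lambda>A. (True, m 0, A \<union> m ` {q + 1..k})) (pmf_of_set (nsub {v..<n} q))"
  using assms
proof (induction "n - v" arbitrary: v q W m T)
  case 0
  then have "nsub {v..<n} q = {{}}" by (auto simp: nsub_def)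
  then show ?case using 0 by (simp add: run_halted pmf_of_set_singleton)
next
  case (Suc d)
  let ?out = "\<lambda>c. (34 \<le> pc c, mem c 0, mem c ` {1..k})"
  let ?F = "\<lambda>A. (True, m 0, A \<union> m ` {q + 1..k})"
  let ?U = "{v + 1..<n}"
  let ?c = "\<lambda>W m v. \<lparr>pc = if v < n then 26 else 34, wreg = W, mem = m, rreg = R\<rparr>"
  have v: "v < n" using Suc.hyps(2) by simp
  have "T \<ge> 8" using Suc.prems(9) v by simp
  then have T2: "T = Suc (Suc (T - 2))" by simp
  define T2 where "T2 = T - 2"
  have T2: "T = Suc (Suc T2)" using T2 by (simp add: T2_def)
  \<comment> \<open>Two instructions end with the random draw and at most five follow, so 8 per
    candidate suffice.\<close>
  have T2': "8 * (n - (v + 1)) \<le> T2 - 5" "5 \<le> T2" using Suc.prems(9) v T2 by auto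
  have mods: "(n - v) mod 2 ^ w = n - v" "Suc v mod 2 ^ w = Suc v" "(q - Suc 0) mod 2 ^ w = q - Suc 0"
    using Suc.prems v by auto
  have run: "run w sampler T (?c W m v) = bind_pmf (pmf_of_set {0..<n - v})
      (\<lambda>r. run w sampler T2 \<lparr>pc = 28, wreg = W(5 := r), mem = m, rreg = R\<rparr>)"
  proof -
    have "run w sampler T (?c W m v) =
        run w sampler (Suc T2) \<lparr>pc = 27, wreg = W(5 := n - v), mem = m, rreg = R\<rparr>"
      using v Suc.prems mods
      by (simp add: T2 step_def halted_def length_sampler sampler_nth set_word_def next_pc_def bind_return_pmf)
    also have "\<dots> = bind_pmf (pmf_of_set {0..<n - v})
        (\<lambda>r. run w sampler T2 \<lparr>pc = 28, wreg = W(5 := r mod 2 ^ w), mem = m, rreg = R\<rparr>)"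
      using v by (simp add: step_def halted_def length_sampler sampler_nth set_word_def next_pc_def bind_map_pmf)
    also have "\<dots> = bind_pmf (pmf_of_set {0..<n - v})
        (\<lambda>r. run w sampler T2 \<lparr>pc = 28, wreg = W(5 := r), mem = m, rreg = R\<rparr>)"
      using v Suc.prems(8) by (intro bind_pmf_cong refl) simp
    finally show ?thesis .
  qed
  have take: "map_pmf ?out (run w sampler T2 \<lparr>pc = 28, wreg = W(5 := r), mem = m, rreg = R\<rparr>) =
      map_pmf ?F (map_pmf (insert v) (pmf_of_set (nsub ?U (q - 1))))" if r: "r < q" for r
  proof -
    have "reach w 5 \<lparr>pc = 28, wreg = W(5 := r), mem = m, rreg = R\<rparr>
        (?c (W(5 := r, 8 := q - 1, 4 := v + 1)) (m(q := v)) (v + 1))"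
      using v Suc.prems mods r by (auto simp: step_simps)
    from reach_run[OF this T2'(2)] obtain b where b: "T2 - 5 \<le> b"
      "run w sampler T2 \<lparr>pc = 28, wreg = W(5 := r), mem = m, rreg = R\<rparr> =
        run w sampler b (?c (W(5 := r, 8 := q - 1, 4 := v + 1)) (m(q := v)) (v + 1))" by blast
    \<comment> \<open>The write goes to cell \<open>q\<close>, and \<open>r < q\<close> rules out
      cell 0, which holds the size.\<close>
    have img: "(\<lambda>A. (True, (m(q := v)) 0, A \<union> (m(q := v)) ` {q - 1 + 1..k})) = ?F \<circ> insert v"
    proof -
      have "{q - 1 + 1..k} = insert q {q + 1..k}" using r Suc.prems(7) by auto
      then have "(m(q := v)) ` {q - 1 + 1..k} = insert v (m ` {q + 1..k})" by auto
      then show ?thesis using r by (intro ext) auto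
    qed
    have "map_pmf ?out (run w sampler b (?c (W(5 := r, 8 := q - 1, 4 := v + 1)) (m(q := v)) (v + 1))) =
        map_pmf (\<lambda>A. (True, (m(q := v)) 0, A \<union> (m(q := v)) ` {q - 1 + 1..k})) (pmf_of_set (nsub ?U (q - 1)))"
      using Suc.prems Suc.hyps(2) v r T2' b(1) by (intro Suc.hyps(1)) auto
    then show ?thesis unfolding b(2) img by (simp only: pmf.map_comp)
  qed
  have skip: "map_pmf ?out (run w sampler T2 \<lparr>pc = 28, wreg = W(5 := r), mem = m, rreg = R\<rparr>) =
      map_pmf ?F (pmf_of_set (nsub ?U q))" if r: "\<not> r < q" "r < n - v" for r
  proof -
    have "reach w 5 \<lparr>pc = 28, wreg = W(5 := r), mem = m, rreg = R\<rparr>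
        (?c (W(5 := r, 4 := v + 1)) m (v + 1))"
      using v Suc.prems mods r by (auto simp: step_simps)
    from reach_run[OF this T2'(2)] obtain b where b: "T2 - 5 \<le> b"
      "run w sampler T2 \<lparr>pc = 28, wreg = W(5 := r), mem = m, rreg = R\<rparr> =
        run w sampler b (?c (W(5 := r, 4 := v + 1)) m (v + 1))" by blast
    show ?thesis unfolding b(2)
      using Suc.prems Suc.hyps(2) v r T2' b(1) by (intro Suc.hyps(1)) auto
  qed
  have "map_pmf ?out (run w sampler T (?c W m v)) = bind_pmf (pmf_of_set {0..<n - v})
      (\<lambda>r. map_pmf ?out (run w sampler T2 \<lparr>pc = 28, wreg = W(5 := r), mem = m, rreg = R\<rparr>))"
    unfolding run by (rule map_bind_pmf)
  also have "\<dots> = bind_pmf (pmf_of_set {0..<n - v}) (\<lambda>r. map_pmf ?F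
      (if r < q then map_pmf (insert v) (pmf_of_set (nsub ?U (q - 1))) else pmf_of_set (nsub ?U q)))"
  proof (intro bind_pmf_cong refl)
    fix r assume "r \<in> set_pmf (pmf_of_set {0..<n - v})"
    then have "r < n - v" using v by simp
    then show "map_pmf ?out (run w sampler T2 \<lparr>pc = 28, wreg = W(5 := r), mem = m, rreg = R\<rparr>) = map_pmf ?F
        (if r < q then map_pmf (insert v) (pmf_of_set (nsub ?U (q - 1))) else pmf_of_set (nsub ?U q))"
      using take[of r] skip[of r] by (simp only: if_True if_False split: if_split) blast
  qed
  also have "\<dots> = map_pmf ?F (bind_pmf (pmf_of_set {0..<Suc (card ?U)}) (\<lambda>r.
      if r < q then map_pmf (insert v) (pmf_of_set (nsub ?U (q - 1))) else pmf_of_set (nsub ?U q)))"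
    using v by (simp add: map_bind_pmf Suc_diff_Suc)
  also have "\<dots> = map_pmf ?F (pmf_of_set (nsub (insert v ?U) q))"
    using v Suc.prems(6) by (subst pmf_of_set_nsub_insert) auto
  finally have "map_pmf ?out (run w sampler T (?c W m v)) = map_pmf ?F (pmf_of_set (nsub (insert v ?U) q))" .
  moreover have "insert v ?U = {v..<n}" using v by auto
  ultimately show ?case by simp
qed

text \<open>Real register 9 is never written and serves as the constant 0, both in the test for
  \<phi>' \<le> 0 and for copying by addition. After scaling, the maximum with 1 is a comparison
  with 4194304.\<close>

lemma sampler_threshold:
  assumes "m 0 = n" "n < 2 ^ w" "4194304 < (2::nat) ^ w"
  shows "\<exists>W R. reach w 17 \<lparr>pc = 0, wreg = (\<lambda>_. 0), mem = m, rreg = (\<lambda>_. 0)(0 := \<epsilon>, 1 := \<phi>')\<rparr>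
           \<lparr>pc = 17, wreg = W, mem = m, rreg = R\<rparr> \<and>
         W 0 = 0 \<and> W 1 = n \<and> W 2 = 0 \<and> W 3 = 1 \<and> W 4 = 0 \<and> R 2 = 4194304 * sample_size n \<epsilon> \<phi>'"
proof -
  let ?W = "(\<lambda>_. 0)(3 := 1, 1 := n, 5 := 4194304) :: nat \<Rightarrow> nat"
  let ?R = "(\<lambda>_. 0)(0 := \<epsilon>, 1 := \<phi>', 2 := 4194304) :: nat \<Rightarrow> real"
  have mods: "n mod 2 ^ w = n" "4194304 mod (2::nat) ^ w = 4194304" "0 < w"
    using assms by (auto intro: Nat.gr0I)
  let ?start = "\<lparr>pc = 0, wreg = (\<lambda>_. 0), mem = m, rreg = (\<lambda>_. 0)(0 := \<epsilon>, 1 := \<phi>')\<rparr>"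
  have 1: "reach w 4 ?start \<lparr>pc = 4, wreg = ?W, mem = m, rreg = ?R\<rparr>"
    using assms mods by (simp add: step_simps)
  show ?thesis
  proof (cases "0 < \<phi>'")
    case False
    then have "reach w 13 \<lparr>pc = 4, wreg = ?W, mem = m, rreg = ?R\<rparr> \<lparr>pc = 17, wreg = ?W, mem = m, rreg = ?R\<rparr>"
      by (simp add: step_simps)
    from reach_trans[OF 1 this]
    have "reach w 17 ?start \<lparr>pc = 17, wreg = ?W, mem = m, rreg = ?R\<rparr>" by simp
    then show ?thesis using False by (intro exI[of _ ?W] exI[of _ ?R]) (simp add: sample_size_def)
  next
    case True
    define y z where "y = real n * \<phi>' / \<epsilon> / \<epsilon> * ln z * 4194304"
      and "z = real n * \<phi>' / \<epsilon> / \<epsilon> / \<epsilon>"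
    let ?R1 = "?R(3 := real n * \<phi>', 4 := y, 5 := ln z)"
    have 2: "reach w 10 \<lparr>pc = 4, wreg = ?W, mem = m, rreg = ?R\<rparr> \<lparr>pc = 14, wreg = ?W, mem = m, rreg = ?R1\<rparr>"
      unfolding y_def z_def using True by (simp add: step_simps fun_upd_twist)
    have "\<exists>R. reach w 3 \<lparr>pc = 14, wreg = ?W, mem = m, rreg = ?R1\<rparr> \<lparr>pc = 17, wreg = ?W, mem = m, rreg = R\<rparr> \<and>
        R 2 = max 4194304 y"
    proof (cases "4194304 < y")
      case True
      then show ?thesis by (intro exI[of _ "?R1(2 := y)"]) (simp add: step_simps)
    next
      case False
      then show ?thesis by (intro exI[of _ ?R1]) (simp add: step_simps)
    qed
    then obtain R where R: "reach w 3 \<lparr>pc = 14, wreg = ?W, mem = m, rreg = ?R1\<rparr> \<lparr>pc = 17, wreg = ?W, mem = m, rreg = R\<rparr>"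
      "R 2 = max 4194304 y" by blast
    from reach_trans[OF 1 reach_trans[OF 2 R(1)]]
    have "reach w 17 ?start \<lparr>pc = 17, wreg = ?W, mem = m, rreg = R\<rparr>" by simp
    moreover have "R 2 = 4194304 * sample_size n \<epsilon> \<phi>'"
    proof -
      define x where "x = real n * (\<phi>' / \<epsilon>\<^sup>2) * ln (real n * \<phi>' / \<epsilon> ^ 3)"
      have "y = 4194304 * x"
        by (simp add: y_def z_def x_def power2_eq_square power3_eq_cube mult_ac)
      moreover have "sample_size n \<epsilon> \<phi>' = max 1 x" using True by (simp add: sample_size_def x_def)
      ultimately show ?thesis unfolding R(2) by (auto simp: max_def)
    qed
    ultimately show ?thesis by (intro exI[of _ ?W] exI[of _ R]) simp
  qed
qed

text \<open>The budget consists of 17 steps for the threshold, 6n + 6 for counting, 2 for storing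
  the size and setting the counter, and 8n for the selection.\<close>

lemma run_sampler:
  assumes "k = capped_size n (base_size n \<epsilon> \<phi>')" "2 * n + 2 < 2 ^ w" "4194304 < (2::nat) ^ w"
    and T: "14 * n + 25 \<le> T" and "1 \<le> n"
  shows "map_pmf (\<lambda>c. (34 \<le> pc c, mem c 0, mem c ` {1..k})) (run w sampler T (init_config n es \<epsilon> \<phi>')) =
    map_pmf (\<lambda>A. (True, k, A)) (pmf_of_set (nsub {..<n} k))"
proof -
  define m where "m = mem (init_config n es \<epsilon> \<phi>')"
  have init: "init_config n es \<epsilon> \<phi>' =
      \<lparr>pc = 0, wreg = (\<lambda>_. 0), mem = m, rreg = (\<lambda>_. 0)(0 := \<epsilon>, 1 := \<phi>')\<rparr>"
    by (simp add: init_config_def m_def)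
  have m0: "m 0 = n" by (simp add: m_def init_config_def encode_graph_def)
  have "n < 2 ^ w" using assms(2) by linarith
  from sampler_threshold[of m n w \<epsilon> \<phi>', OF m0 this assms(3)] obtain W R where 1: "reach w 17 (init_config n es \<epsilon> \<phi>')
           \<lparr>pc = 17, wreg = W, mem = m, rreg = R\<rparr>"
    "W 0 = 0" "W 1 = n" "W 2 = 0" "W 3 = 1" "W 4 = 0" "R 2 = 4194304 * sample_size n \<epsilon> \<phi>'"
    unfolding init by blast
  have "1 \<le> sample_size n \<epsilon> \<phi>'" by (simp add: sample_size_def)
  then have "real 0 < R 2" using 1(7) by simp
  from count_loop[where m = m and W = W and R = R and n = n and j = 0, OF 1(2-6) this _ assms(2)]
  obtain W' R' where 2:
    "reach w (6 * n + 6) \<lparr>pc = 17, wreg = W, mem = m, rreg = R\<rparr> \<lparr>pc = 24, wreg = W', mem = m, rreg = R'\<rparr>"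
    "W' 0 = 0" "W' 1 = n" "W' 2 = k" "W' 3 = 1" "W' 4 = 0"
    using 1(7) assms(1) by (auto simp: base_size_def)
  have kn: "k \<le> n" by (simp add: assms(1) capped_size_def)
  let ?c = "\<lparr>pc = if 0 < n then 26 else 34, wreg = W'(8 := k), mem = m(0 := k), rreg = R'\<rparr>"
  have "reach w 2 \<lparr>pc = 24, wreg = W', mem = m, rreg = R'\<rparr> ?c"
    using 2(2-) kn \<open>n < 2 ^ w\<close> assms(5) by (simp add: step_simps)
  note r = reach_trans[OF 1(1) reach_trans[OF 2(1) this]]
  have "17 + (6 * n + 6 + 2) \<le> T" using T by simp
  from reach_run[OF r this] obtain b where b: "T - (17 + (6 * n + 6 + 2)) \<le> b"
    "run w sampler T (init_config n es \<epsilon> \<phi>') = run w sampler b ?c" by blast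
  have "map_pmf (\<lambda>c. (34 \<le> pc c, mem c 0, mem c ` {1..k})) (run w sampler b ?c) =
      map_pmf (\<lambda>A. (True, (m(0 := k)) 0, A \<union> (m(0 := k)) ` {k + 1..k})) (pmf_of_set (nsub {0..<n} k))"
    using 2(2-) kn \<open>n < 2 ^ w\<close> b(1) T by (intro selection_loop) auto
  then show ?thesis unfolding b(2) by (simp add: lessThan_atLeast0)
qed

theorem lemma4p7:
  shows "\<exists>s. is_sample_size_fun s \<and>
    (\<forall>(V :: nat set) E \<epsilon> \<phi>'. connected_graph V E \<and> 0 < \<epsilon> \<and> \<epsilon> < 1 \<and> \<phi>' < 1 / 2 \<longrightarrow>
       (\<exists>T. vertex_sample_set V E \<epsilon> \<phi>' T \<and> card T = min (s (card V) \<epsilon> \<phi>') (card V))) \<and>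
    (\<exists>P \<kappa> C d p. 0 < p \<and> computes_sample_sets s P \<kappa> C d p)"
proof -
  define s where "s = (\<lambda>n \<epsilon> \<phi>'. if n < 2 * base_size n \<epsilon> \<phi>' then 2 * base_size n \<epsilon> \<phi>' else base_size n \<epsilon> \<phi>')"
  have min_s: "min (s n \<epsilon> \<phi>') n = capped_size n (base_size n \<epsilon> \<phi>')" for n \<epsilon> \<phi>'
    by (simp add: s_def capped_size_def)
  have size: "is_sample_size_fun s"
    unfolding is_sample_size_fun_def
  proof (rule exI[of _ 1], rule conjI, simp, rule exI[of _ 16777216], intro conjI allI impI)
    fix n \<epsilon> \<phi>'
    have "1 \<le> sample_size n \<epsilon> \<phi>'" by (simp add: sample_size_def)
    with base_size_bounds[of n \<epsilon> \<phi>']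
    show "1 * sample_size n \<epsilon> \<phi>' \<le> real (s n \<epsilon> \<phi>')" "real (s n \<epsilon> \<phi>') \<le> 16777216 * sample_size n \<epsilon> \<phi>'"
      unfolding s_def by auto
  qed auto
  have exists: "\<exists>T. vertex_sample_set V E \<epsilon> \<phi>' T \<and> card T = min (s (card V) \<epsilon> \<phi>') (card V)"
    if G: "connected_graph V E" "0 < \<epsilon>" "\<epsilon> < 1" "\<phi>' < 1 / 2" for V :: "nat set" and E \<epsilon> \<phi>'
  proof (rule ccontr)
    assume no: "\<not> ?thesis"
    let ?k = "capped_size (card V) (base_size (card V) \<epsilon> \<phi>')"
    have "{T \<in> nsub V ?k. \<not> vertex_sample_set V E \<epsilon> \<phi>' T} = nsub V ?k"
      using no unfolding min_s by (auto simp: nsub_def)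
    with half_samples_good[OF G refl] connected_graph_finite[OF G(1)]
    have "real (card V choose ?k) \<le> 0" by (simp add: card_nsub)
    moreover have "?k \<le> card V" by (simp add: capped_size_def)
    ultimately show False by (simp add: binomial_eq_0_iff)
  qed
  \<comment> \<open>The 24 gives (n + 2)^24 \<le> 2^w and thus 2^23 (n + 2) \<le> 2^w, which leaves
    room for 4194304 = 2^22 and for 2n + 2 even if n is small. The time is linear without
    logarithms: n \<le> 2m + 1 gives 14n + 25 \<le> 40 (m + 1).\<close>
  have "computes_sample_sets s sampler 24 40 0 (1 / 2)"
    unfolding computes_sample_sets_def Let_def
  proof (intro allI impI, elim conjE)
    fix n :: nat and E :: "nat set set" and es :: "(nat \<times> nat) list" and \<epsilon> \<phi>' :: real and w :: nat
    assume G: "connected_graph {..<n} E" "0 < \<epsilon>" "\<epsilon> < 1" "\<phi>' < 1 / 2"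
      and w: "real 24 * log 2 (real n + 2) \<le> real w"
    let ?T = "nat \<lfloor>40 * (real (card E) + 1) * log 2 (real n + 2) ^ 0\<rfloor>"
    let ?D = "run w sampler ?T (init_config n es \<epsilon> \<phi>')"
    define k where "k = capped_size n (base_size n \<epsilon> \<phi>')"
    let ?N = "nsub {..<n} k"
    let ?out = "\<lambda>c. (34 \<le> pc c, mem c 0, mem c ` {1..k})"
    have n: "n \<ge> 1" using connected_graph_finite[OF G(1)] by (cases n) auto
    have "?T = 40 * (card E + 1)"
    proof -
      have "40 * (real (card E) + 1) * log 2 (real n + 2) ^ 0 = real_of_int (int (40 * (card E + 1)))" by simp
      then show ?thesis by (simp only: floor_of_int nat_int)
    qed
    then have T: "14 * n + 25 \<le> ?T" using connected_graph_card_le[OF G(1)] by simp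
    have pow: "(n + 2) ^ 24 \<le> 2 ^ w"
    proof -
      have "log 2 ((real n + 2) ^ 24) \<le> real w" using w by (simp add: log_nat_power)
      then have "(real n + 2) ^ 24 \<le> 2 ^ w" by (simp add: log_le_iff powr_realpow)
      then have "real ((n + 2) ^ 24) \<le> real (2 ^ w)" by (simp add: add.commute)
      then show ?thesis by (simp only: of_nat_le_iff)
    qed
    have "2 ^ 23 * (n + 2) \<le> (n + 2) ^ 23 * (n + 2)" by (intro mult_right_mono power_mono) auto
    also have "\<dots> = (n + 2) ^ 24" using power_Suc2[of "n + 2" 23] by simp
    finally have "2 ^ 23 * (n + 2) \<le> (2::nat) ^ w" using pow by (rule order_trans)
    then have w': "2 * n + 2 < 2 ^ w" "4194304 < (2::nat) ^ w" by auto
    have out: "map_pmf ?out ?D = map_pmf (\<lambda>A. (True, k, A)) (pmf_of_set ?N)"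
      by (rule run_sampler[OF k_def w' T n])
    have kn: "k \<le> n" by (simp add: k_def capped_size_def)
    then have N: "?N \<noteq> {}" "finite ?N" "card ?N = n choose k"
      by (simp_all add: nsub_nonempty finite_nsub card_nsub)
    have halt: "\<forall>c\<in>set_pmf ?D. halted sampler c"
    proof
      fix c assume "c \<in> set_pmf ?D"
      then have "?out c \<in> set_pmf (map_pmf ?out ?D)" by auto
      then show "halted sampler c" unfolding out by (auto simp: halted_def length_sampler)
    qed
    let ?good = "\<lambda>A. vertex_sample_set {..<n} E \<epsilon> \<phi>' A \<and> card A = min (s n \<epsilon> \<phi>') n"
    have "1 / 2 \<le> measure_pmf.prob (pmf_of_set ?N) {A. ?good A}"
    proof -
      let ?bad = "{A \<in> ?N. \<not> vertex_sample_set {..<n} E \<epsilon> \<phi>' A}"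
      have "?N \<inter> {A. ?good A} = ?N - ?bad" by (auto simp: nsub_def min_s k_def)
      then have "real (card (?N \<inter> {A. ?good A})) = real (n choose k) - real (card ?bad)"
        using N by (simp add: card_Diff_subset of_nat_diff card_mono flip: N(3))
      moreover have "real (card ?bad) \<le> 1 / 2 * real (n choose k)"
        using half_samples_good[OF G, of k] by (simp add: k_def)
      ultimately have "1 / 2 * real (n choose k) \<le> real (card (?N \<inter> {A. ?good A}))" by simp
      moreover have "real (n choose k) > 0" using kn by (simp add: zero_less_binomial_iff)
      ultimately show ?thesis using N by (simp add: measure_pmf_of_set field_simps)
    qed
    also have "\<dots> = measure_pmf.prob (map_pmf (\<lambda>A. (True, k, A)) (pmf_of_set ?N)) {(h, x, A). x = k \<and> ?good A}"
      by (simp add: vimage_def)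
    also have "\<dots> = measure_pmf.prob ?D {c. mem c 0 = k \<and> ?good (mem c ` {1..k})}"
      unfolding out[symmetric] by (simp add: vimage_def)
    also have "\<dots> \<le> measure_pmf.prob ?D {c. ?good (output_set c)}"
      by (intro measure_pmf.finite_measure_mono) (auto simp: output_set_def)
    finally show "(\<forall>c\<in>set_pmf ?D. halted sampler c) \<and>
        1 / 2 \<le> measure_pmf.prob ?D {c. ?good (output_set c)}"
      using halt by blast
  qed
  then have "\<exists>P \<kappa> C d p. 0 < p \<and> computes_sample_sets s P \<kappa> C d p"
    by (metis half_gt_zero zero_less_one)
  with size exists show ?thesis by blast
qed

end
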